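(* Let $p$ be an odd prime and let $G$ be a non-abelian group of order $2p^2$. Then $G$ is a t-group if and only if $G$ is isomorphic either to the dihedral group $D_{2p^2}$ of order $2p^2$ or to the semidirect product $(C_p)^2\rtimes C_2=\langle a,b,c \mid a^p=b^p=c^2=1,\ [a,b]=1,\ (ac)^2=(bc)^2=1\rangle$ (in which $C_2=\langle c\rangle$ acts on $(C_p)^2=\langle a,b\rangle$ by inversion).
   Context: All groups are finite. $C_k$ denotes the cyclic group of order $k$. Let $G$ be a finite group and $H\le G$. A normalized right transversal (NRT) of $H$ in $G$ is a subset $S\subseteq G$ containing exactly one element from each right coset of $H$ in $G$ and with $1\in S$. $\mathcal{T}(G,H)$ denotes the set of all NRTs of $H$ in $G$. Each NRT $S$ carries the binary operation $\circ$ defined by $\{x\circ y\}=S\cap Hxy$, which makes $S$ a right loop with identity $1$. Two NRTs (possibly of different subgroups) are isomorphic, written $S_1\cong S_2$, if there is a bijection between them preserving these operations. For a divisor $d$ of $|G|$, the transiso graph $\Gamma_d(G)$ is the simple graph whose vertices are the subgroups of $G$ of order $d$, two distinct vertices $H_1,H_2$ being adjacent if and only if there exist $S_1\in\mathcal{T}(G,H_1)$ and $S_2\in\mathcal{T}(G,H_2)$ with $S_1\cong S_2$. A graph is complete if any two distinct vertices are adjacent (so graphs with at most one vertex are complete). A finite group $G$ is a t-group if $\Gamma_d(G)$ is complete for every divisor $d$ of $|G|$. *)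

theory Defs
  imports "HOL-Algebra.Algebra" "Graph_Theory.Kuratowski"
begin

section \<open>Normalized right transversals and the transiso graph\<close>

definition NRT :: "('a, 'm) monoid_scheme \<Rightarrow> 'a set \<Rightarrow> 'a set set" where
  "NRT G H = {S. S \<subseteq> carrier G \<and> \<one>\<^bsub>G\<^esub> \<in> S \<and> (\<forall>C \<in> rcosets\<^bsub>G\<^esub> H. \<exists>!x. x \<in> S \<inter> C)}"

text \<open>The induced right loop need not be associative; \<^typ>\<open>'a monoid\<close> serves here only as a
  record of a carrier, an operation and an identity.  Isomorphism of such right loops is
  \<^const>\<open>is_iso\<close>, which asks for a bijection of the carriers preserving the operations.\<close>

definition NRT_loop :: "('a, 'm) monoid_scheme \<Rightarrow> 'a set \<Rightarrow> 'a set \<Rightarrow> 'a monoid" where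
  "NRT_loop G H S =
    \<lparr>carrier = S,
     monoid.mult = (\<lambda>x y. the_elem (S \<inter> (H #>\<^bsub>G\<^esub> (x \<otimes>\<^bsub>G\<^esub> y)))),
     one = \<one>\<^bsub>G\<^esub>\<rparr>"

text \<open>A simple graph is represented as a symmetric, loop-free set of pairs of vertices.\<close>

definition transiso_graph :: "('a, 'm) monoid_scheme \<Rightarrow> nat \<Rightarrow> 'a set pair_pre_digraph" where
  "transiso_graph G d =
    \<lparr>pverts = {H. subgroup H G \<and> card H = d},
     parcs = {(H1, H2). subgroup H1 G \<and> card H1 = d \<and> subgroup H2 G \<and> card H2 = d \<and> H1 \<noteq> H2 \<and>
        (\<exists>S1 \<in> NRT G H1. \<exists>S2 \<in> NRT G H2. NRT_loop G H1 S1 \<cong> NRT_loop G H2 S2)}\<rparr>"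

definition t_group :: "('a, 'm) monoid_scheme \<Rightarrow> bool" where
  "t_group G \<longleftrightarrow> group G \<and> finite (carrier G) \<and>
    (\<forall>d. d dvd order G \<longrightarrow> (\<exists>n. complete_digraph n (with_proj (transiso_graph G d))))"

lemma NRT_loop_mult:
  assumes G: "group G" and H: "subgroup H G" and S: "S \<in> NRT G H" and xy: "x \<in> S" "y \<in> S"
  shows "{x \<otimes>\<^bsub>NRT_loop G H S\<^esub> y} = S \<inter> (H #>\<^bsub>G\<^esub> (x \<otimes>\<^bsub>G\<^esub> y))"
proof -
  interpret group G by (rule G)
  have "x \<otimes>\<^bsub>G\<^esub> y \<in> carrier G" using S xy by (auto simp: NRT_def)
  then have "H #>\<^bsub>G\<^esub> (x \<otimes>\<^bsub>G\<^esub> y) \<in> rcosets\<^bsub>G\<^esub> H"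
    by (auto simp: RCOSETS_def)
  then have "\<exists>!z. z \<in> S \<inter> (H #>\<^bsub>G\<^esub> (x \<otimes>\<^bsub>G\<^esub> y))" using S by (auto simp: NRT_def)
  then obtain z where "S \<inter> (H #>\<^bsub>G\<^esub> (x \<otimes>\<^bsub>G\<^esub> y)) = {z}" by blast
  then show ?thesis by (simp add: NRT_loop_def)
qed

section \<open>Semidirect products and generalized dihedral groups\<close>

definition semidirect_product ::
  "('a, 'm) monoid_scheme \<Rightarrow> ('b, 'n) monoid_scheme \<Rightarrow> ('b \<Rightarrow> 'a \<Rightarrow> 'a) \<Rightarrow> ('a \<times> 'b) monoid" where
  "semidirect_product N K \<phi> =
    \<lparr>carrier = carrier N \<times> carrier K,
     monoid.mult = (\<lambda>(x, h) (y, k). (x \<otimes>\<^bsub>N\<^esub> \<phi> h y, h \<otimes>\<^bsub>K\<^esub> k)),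
     one = (\<one>\<^bsub>N\<^esub>, \<one>\<^bsub>K\<^esub>)\<rparr>"

lemma group_semidirect_product:
  assumes N: "group N" and K: "group K" and hom: "\<phi> \<in> hom K (AutoGroup N)"
  shows "group (semidirect_product N K \<phi>)"
proof -
  interpret N: group N by (rule N)
  interpret K: group K by (rule K)
  have aut: "\<phi> h \<in> auto N" if "h \<in> carrier K" for h
    using hom that by (auto simp: hom_def AutoGroup_def BijGroup_def)
  have closed: "\<phi> h x \<in> carrier N" if "h \<in> carrier K" "x \<in> carrier N" for h x
    using aut[OF that(1)] that(2) by (auto simp: auto_def hom_def)
  have mult: "\<phi> h (x \<otimes>\<^bsub>N\<^esub> y) = \<phi> h x \<otimes>\<^bsub>N\<^esub> \<phi> h y"
    if "h \<in> carrier K" "x \<in> carrier N" "y \<in> carrier N" for h x y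
    using aut[OF that(1)] that(2,3) by (auto simp: auto_def hom_def)
  have comp: "\<phi> (h \<otimes>\<^bsub>K\<^esub> k) x = \<phi> h (\<phi> k x)"
    if "h \<in> carrier K" "k \<in> carrier K" "x \<in> carrier N" for h k x
  proof -
    have "\<phi> (h \<otimes>\<^bsub>K\<^esub> k) = \<phi> h \<otimes>\<^bsub>AutoGroup N\<^esub> \<phi> k"
      using hom that by (auto simp: hom_def)
    also have "\<dots> = compose (carrier N) (\<phi> h) (\<phi> k)"
      using aut[OF that(1)] aut[OF that(2)]
      by (auto simp: AutoGroup_def BijGroup_def auto_def)
    finally show ?thesis using that by (simp add: compose_eq)
  qed
  have inj: "inj_on (\<phi> h) (carrier N)" if "h \<in> carrier K" for h
    using aut[OF that] by (auto simp: auto_def Bij_def bij_betw_def)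
  have one: "\<phi> \<one>\<^bsub>K\<^esub> x = x" if "x \<in> carrier N" for x
  proof -
    have "\<phi> \<one>\<^bsub>K\<^esub> (\<phi> \<one>\<^bsub>K\<^esub> x) = \<phi> \<one>\<^bsub>K\<^esub> x"
      using comp[of "\<one>\<^bsub>K\<^esub>" "\<one>\<^bsub>K\<^esub>" x] that by simp
    then show ?thesis
      using inj[of "\<one>\<^bsub>K\<^esub>"] closed[of "\<one>\<^bsub>K\<^esub>" x] that by (auto dest: inj_onD)
  qed
  show ?thesis
  proof (rule groupI)
    fix u v w
    assume "u \<in> carrier (semidirect_product N K \<phi>)" "v \<in> carrier (semidirect_product N K \<phi>)"
      "w \<in> carrier (semidirect_product N K \<phi>)"
    then show "u \<otimes>\<^bsub>semidirect_product N K \<phi>\<^esub> v \<otimes>\<^bsub>semidirect_product N K \<phi>\<^esub> w =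
      u \<otimes>\<^bsub>semidirect_product N K \<phi>\<^esub> (v \<otimes>\<^bsub>semidirect_product N K \<phi>\<^esub> w)"
      by (auto simp: semidirect_product_def closed mult comp N.m_assoc K.m_assoc)
  next
    fix u assume u: "u \<in> carrier (semidirect_product N K \<phi>)"
    then obtain x h where xh: "u = (x, h)" "x \<in> carrier N" "h \<in> carrier K"
      by (auto simp: semidirect_product_def)
    let ?y = "\<phi> (inv\<^bsub>K\<^esub> h) (inv\<^bsub>N\<^esub> x)"
    have "?y \<otimes>\<^bsub>N\<^esub> \<phi> (inv\<^bsub>K\<^esub> h) x = \<phi> (inv\<^bsub>K\<^esub> h) \<one>\<^bsub>N\<^esub>"
      using xh mult[of "inv\<^bsub>K\<^esub> h" "inv\<^bsub>N\<^esub> x" x] by simp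
    also have "\<dots> = \<one>\<^bsub>N\<^esub>"
      using xh mult[of "inv\<^bsub>K\<^esub> h" "\<one>\<^bsub>N\<^esub>" "\<one>\<^bsub>N\<^esub>"] closed[of "inv\<^bsub>K\<^esub> h" "\<one>\<^bsub>N\<^esub>"]
      by (simp add: N.l_cancel_one)
    finally show "\<exists>v \<in> carrier (semidirect_product N K \<phi>).
        v \<otimes>\<^bsub>semidirect_product N K \<phi>\<^esub> u = \<one>\<^bsub>semidirect_product N K \<phi>\<^esub>"
      using xh by (intro bexI[of _ "(?y, inv\<^bsub>K\<^esub> h)"]) (auto simp: semidirect_product_def closed)
  qed (auto simp: semidirect_product_def closed one)
qed

text \<open>The action of \<open>C\<^sub>2\<close>, written additively as \<open>{0, 1}\<close>, on an abelian group by inversion.\<close>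

definition inversion_action :: "('a, 'm) monoid_scheme \<Rightarrow> int \<Rightarrow> 'a \<Rightarrow> 'a" where
  "inversion_action A k = (\<lambda>x \<in> carrier A. if k = 0 then x else inv\<^bsub>A\<^esub> x)"

lemma inversion_action_hom:
  assumes "comm_group A"
  shows "inversion_action A \<in> hom (integer_mod_group 2) (AutoGroup A)"
proof -
  interpret comm_group A by (rule assms)
  have aut: "inversion_action A k \<in> auto A" for k
  proof -
    have "inversion_action A k \<in> hom A A"
      by (auto simp: inversion_action_def hom_def inv_mult)
    moreover have "bij_betw (inversion_action A k) (carrier A) (carrier A)"
      by (rule bij_betw_byWitness[of _ "inversion_action A k"])
        (auto simp: inversion_action_def)
    ultimately show ?thesis by (simp add: auto_def Bij_def inversion_action_def)
  qed
  have "inversion_action A ((h + k) mod 2) =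
      compose (carrier A) (inversion_action A h) (inversion_action A k)"
    if "h \<in> {0..<2}" "k \<in> {0..<2}" for h k
  proof -
    have "h = 0 \<or> h = 1" "k = 0 \<or> k = 1" using that by auto
    then show ?thesis by (auto simp: inversion_action_def compose_def fun_eq_iff)
  qed
  then show ?thesis
    using aut by (auto simp: hom_def AutoGroup_def BijGroup_def carrier_integer_mod_group auto_def)
qed

definition generalized_dihedral_group :: "('a, 'm) monoid_scheme \<Rightarrow> ('a \<times> int) monoid" where
  "generalized_dihedral_group A =
    semidirect_product A (integer_mod_group 2) (inversion_action A)"

lemma group_generalized_dihedral_group:
  "comm_group A \<Longrightarrow> group (generalized_dihedral_group A)"
  unfolding generalized_dihedral_group_def
  by (intro group_semidirect_product inversion_action_hom) (auto simp: comm_group.axioms)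

lemma order_generalized_dihedral_group:
  "order (generalized_dihedral_group A) = 2 * order A"
  by (simp add: generalized_dihedral_group_def semidirect_product_def order_def
      card_cartesian_product carrier_integer_mod_group)

text \<open>Indexed by the order \<open>n\<close> of the rotation subgroup: this group has order \<open>2 * n\<close>.\<close>

definition dihedral_group :: "nat \<Rightarrow> (int \<times> int) monoid" where
  "dihedral_group n = generalized_dihedral_group (integer_mod_group n)"

definition Cp2_C2 :: "nat \<Rightarrow> ((int \<times> int) \<times> int) monoid" where
  "Cp2_C2 p = generalized_dihedral_group (integer_mod_group p \<times>\<times> integer_mod_group p)"

text \<open>
  The standard generators of \<^term>\<open>Cp2_C2 p\<close> satisfy the defining relations of
  \<open>\<langle>a, b, c | a\<^sup>p = b\<^sup>p = c\<^sup>2 = 1, [a, b] = 1, (ac)\<^sup>2 = (bc)\<^sup>2 = 1\<rangle>\<close>.  By these relations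
  every element of the presented group has the form \<open>a\<^sup>i b\<^sup>j c\<^sup>k\<close> with \<open>i, j < p\<close> and \<open>k < 2\<close>, so
  the presented group has at most \<open>2 * p ^ 2\<close> elements and is therefore this one.
\<close>

lemma Cp2_C2_presentation:
  fixes p :: nat
  assumes p: "p > 1"
  defines "G \<equiv> Cp2_C2 p"
  defines "a \<equiv> ((1, 0), 0)" and "b \<equiv> ((0, 1), 0)" and "c \<equiv> ((0, 0), 1)"
  shows "group G" and "order G = 2 * p ^ 2"
    and "a \<in> carrier G" "b \<in> carrier G" "c \<in> carrier G"
    and "carrier G = {a [^]\<^bsub>G\<^esub> i \<otimes>\<^bsub>G\<^esub> b [^]\<^bsub>G\<^esub> j \<otimes>\<^bsub>G\<^esub> c [^]\<^bsub>G\<^esub> k | i j k :: nat. i < p \<and> j < p \<and> k < 2}"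
    and "a [^]\<^bsub>G\<^esub> p = \<one>\<^bsub>G\<^esub>" "b [^]\<^bsub>G\<^esub> p = \<one>\<^bsub>G\<^esub>" "c [^]\<^bsub>G\<^esub> (2::nat) = \<one>\<^bsub>G\<^esub>"
    and "a \<otimes>\<^bsub>G\<^esub> b = b \<otimes>\<^bsub>G\<^esub> a"
    and "(a \<otimes>\<^bsub>G\<^esub> c) [^]\<^bsub>G\<^esub> (2::nat) = \<one>\<^bsub>G\<^esub>" "(b \<otimes>\<^bsub>G\<^esub> c) [^]\<^bsub>G\<^esub> (2::nat) = \<one>\<^bsub>G\<^esub>"
proof -
  let ?A = "integer_mod_group p \<times>\<times> integer_mod_group p"
  have A: "comm_group ?A"
    by (rule group.group_comm_groupI) (auto simp: DirProd_group add.commute)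
  show grp: "group G"
    unfolding G_def Cp2_C2_def by (rule group_generalized_dihedral_group[OF A])
  interpret group G by (rule grp)
  show "order G = 2 * p ^ 2"
    using p unfolding G_def Cp2_C2_def order_generalized_dihedral_group
    by (simp add: order_def DirProd_def card_cartesian_product carrier_integer_mod_group
        power2_eq_square)
  have car: "carrier G = ({0..<int p} \<times> {0..<int p}) \<times> {0..<2}"
    using p by (simp add: G_def Cp2_C2_def generalized_dihedral_group_def semidirect_product_def
        DirProd_def carrier_integer_mod_group)
  have one: "\<one>\<^bsub>G\<^esub> = ((0, 0), 0)"
    by (simp add: G_def Cp2_C2_def generalized_dihedral_group_def semidirect_product_def DirProd_def)
  have mult: "((x, y), h) \<otimes>\<^bsub>G\<^esub> ((x', y'), k) =
      (if h = 0 then ((x + x') mod p, (y + y') mod p) else ((x - x') mod p, (y - y') mod p),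
       (h + k) mod 2)"
    if "x' \<in> {0..<int p}" "y' \<in> {0..<int p}" for x y x' y' h k
  proof -
    have "inv\<^bsub>?A\<^esub> (x', y') = ((- x') mod p, (- y') mod p)"
      using that p by (subst inv_DirProd) (auto simp: carrier_integer_mod_group)
    then show ?thesis
      using that p by (auto simp: G_def Cp2_C2_def generalized_dihedral_group_def
        semidirect_product_def inversion_action_def carrier_integer_mod_group mod_add_right_eq)
  qed
  show abc: "a \<in> carrier G" "b \<in> carrier G" "c \<in> carrier G"
    using p by (auto simp: car a_def b_def c_def)
  have pow_a: "a [^]\<^bsub>G\<^esub> i = ((int i mod p, 0), 0)" for i :: nat
    using p by (induction i) (auto simp: one a_def mult mod_simps add.commute)
  have pow_b: "b [^]\<^bsub>G\<^esub> i = ((0, int i mod p), 0)" for i :: nat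
    using p by (induction i) (auto simp: one b_def mult mod_simps add.commute)
  have pow_c: "c [^]\<^bsub>G\<^esub> i = ((0, 0), int i mod 2)" for i :: nat
    using p by (induction i) (auto simp: one c_def mult mod_simps add.commute)
  have word: "a [^]\<^bsub>G\<^esub> i \<otimes>\<^bsub>G\<^esub> b [^]\<^bsub>G\<^esub> j \<otimes>\<^bsub>G\<^esub> c [^]\<^bsub>G\<^esub> k = ((int i, int j), int k)"
    if "i < p" "j < p" "k < 2" for i j k :: nat
    using p that by (simp add: pow_a pow_b pow_c mult)
  show "carrier G = {a [^]\<^bsub>G\<^esub> i \<otimes>\<^bsub>G\<^esub> b [^]\<^bsub>G\<^esub> j \<otimes>\<^bsub>G\<^esub> c [^]\<^bsub>G\<^esub> k | i j k :: nat. i < p \<and> j < p \<and> k < 2}"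
    (is "_ = ?R")
  proof
    show "carrier G \<subseteq> ?R"
    proof
      fix u assume "u \<in> carrier G"
      then obtain x y h where u: "u = ((x, y), h)" "0 \<le> x" "x < p" "0 \<le> y" "y < p" "0 \<le> h" "h < 2"
        by (auto simp: car)
      then have "u = a [^]\<^bsub>G\<^esub> nat x \<otimes>\<^bsub>G\<^esub> b [^]\<^bsub>G\<^esub> nat y \<otimes>\<^bsub>G\<^esub> c [^]\<^bsub>G\<^esub> nat h"
        by (subst word) auto
      moreover have "nat x < p" "nat y < p" "nat h < 2" using u by auto
      ultimately show "u \<in> ?R" by blast
    qed
    show "?R \<subseteq> carrier G" using abc by auto
  qed
  show "a [^]\<^bsub>G\<^esub> p = \<one>\<^bsub>G\<^esub>" "b [^]\<^bsub>G\<^esub> p = \<one>\<^bsub>G\<^esub>" "c [^]\<^bsub>G\<^esub> (2::nat) = \<one>\<^bsub>G\<^esub>"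
    by (simp_all add: pow_a pow_b pow_c one)
  show "a \<otimes>\<^bsub>G\<^esub> b = b \<otimes>\<^bsub>G\<^esub> a"
    using p by (simp add: a_def b_def mult)
  show "(a \<otimes>\<^bsub>G\<^esub> c) [^]\<^bsub>G\<^esub> (2::nat) = \<one>\<^bsub>G\<^esub>" "(b \<otimes>\<^bsub>G\<^esub> c) [^]\<^bsub>G\<^esub> (2::nat) = \<one>\<^bsub>G\<^esub>"
    using p abc by (simp_all add: numeral_2_eq_2 one a_def b_def c_def mult)
qed

end

theory Submission
  imports Defs
begin

text \<open>
  Let \<open>P\<close> be the Sylow \<open>p\<close>-subgroup, which is abelian of index two, and let \<open>c\<close> be an involution.  Since
  \<open>P\<close> has odd order, it is the direct product of the subgroups \<open>F\<close> and \<open>I\<close> of elements which \<open>c\<close> fixes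
  and inverts, respectively.  If both are nontrivial, they are normal of order \<open>p\<close>; as the transversals
  of a normal subgroup \<open>N\<close> are all isomorphic to \<open>G/N\<close>, and \<open>G/I\<close> is abelian while \<open>G/F\<close> is not, \<open>G\<close> is
  not a t-group.  Otherwise \<open>c\<close>, not being central, inverts \<open>P\<close>, which is cyclic or elementary abelian.

  Conversely, let \<open>c\<close> invert \<open>P\<close>.  If two subgroups of the same order meet a subgroup \<open>K\<close> in the same
  subgroup and both have full product with \<open>K\<close>, then a transversal of the intersection in \<open>K\<close> is a
  common transversal with the same loop operation.  Such a \<open>K\<close> always exists: it is \<open>P\<close>, or a subgroup \<open>M\<close>
  of order \<open>p\<close> of \<open>P\<close> that avoids both subgroups, or \<open>M \<union> Mc\<close>.
\<close>

section \<open>The transiso graph\<close>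

text \<open>The number \<open>n\<close> in \<open>complete_digraph n\<close> is just the number of
  vertices, finite because \<open>carrier G\<close> is, and by Lagrange the order of every subgroup
  is one of the divisors \<open>d\<close>. So the condition on all graphs becomes one on pairs of
  distinct subgroups of equal order.\<close>

lemma t_group_iff:
  "t_group G \<longleftrightarrow> group G \<and> finite (carrier G) \<and>
    (\<forall>H1 H2. subgroup H1 G \<and> subgroup H2 G \<and> card H1 = card H2 \<and> H1 \<noteq> H2 \<longrightarrow>
      (\<exists>S1 \<in> NRT G H1. \<exists>S2 \<in> NRT G H2. NRT_loop G H1 S1 \<cong> NRT_loop G H2 S2))"
  (is "_ \<longleftrightarrow> group G \<and> finite (carrier G) \<and> ?adj")
proof -
  have "(\<forall>d. d dvd order G \<longrightarrow> (\<exists>n. complete_digraph n (with_proj (transiso_graph G d)))) \<longleftrightarrow> ?adj"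
    if "group G" and fin: "finite (carrier G)"
  proof -
    interpret group G by fact
    have "finite {H. subgroup H G \<and> card H = d}" for d
      by (rule finite_subset[of _ "Pow (carrier G)"]) (use fin subgroup.subset in auto)
    then have "(\<exists>n. complete_digraph n (with_proj (transiso_graph G d))) \<longleftrightarrow>
        (\<forall>H1 H2. subgroup H1 G \<and> card H1 = d \<and> subgroup H2 G \<and> card H2 = d \<and> H1 \<noteq> H2 \<longrightarrow>
          (\<exists>S1 \<in> NRT G H1. \<exists>S2 \<in> NRT G H2. NRT_loop G H1 S1 \<cong> NRT_loop G H2 S2))" for d
      unfolding complete_digraph_pair_def by (simp add: transiso_graph_def set_eq_iff) blast
    moreover have "card H dvd order G" if "subgroup H G" for H
      using lagrange[OF that] by (metis dvd_triv_right)
    ultimately show ?thesis by metis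
  qed
  then show ?thesis unfolding t_group_def by blast
qed

section \<open>Normalized right transversals\<close>

context group
begin

lemma rcos_eq_iff:
  assumes "subgroup H G" "x \<in> carrier G" "y \<in> carrier G"
  shows "H #> x = H #> y \<longleftrightarrow> x \<otimes> inv y \<in> H"
proof
  assume "H #> x = H #> y"
  then have "x \<in> H #> y" using rcos_self assms by blast
  then obtain h where "h \<in> H" "x = h \<otimes> y" by (auto simp: r_coset_def)
  then show "x \<otimes> inv y \<in> H" using assms subgroup.mem_carrier by (fastforce simp: m_assoc)
next
  assume xy: "x \<otimes> inv y \<in> H"
  have "x = (x \<otimes> inv y) \<otimes> y" using assms by (simp add: m_assoc)
  with xy have "x \<in> H #> y" by (auto simp: r_coset_def)
  then show "H #> x = H #> y" using repr_independence assms by blast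
qed

lemma rcos_mem_iff:
  assumes "subgroup H G" "x \<in> carrier G" "y \<in> carrier G"
  shows "x \<in> H #> y \<longleftrightarrow> x \<otimes> inv y \<in> H"
proof -
  have "x \<in> H #> y \<longleftrightarrow> H #> x = H #> y"
    using assms rcos_self[of x H] repr_independence[of x H y] by blast
  then show ?thesis using rcos_eq_iff[OF assms] by simp
qed

text \<open>A coset contains \<open>s\<close> exactly when it equals \<open>H #> s\<close>, so
  having unique representatives amounts to a bijection. In this form sizes can be counted and the
  coset map can be inverted.\<close>

lemma NRT_iff:
  assumes "subgroup H G"
  shows "S \<in> NRT G H \<longleftrightarrow> S \<subseteq> carrier G \<and> \<one> \<in> S \<and> bij_betw (\<lambda>s. H #> s) S (rcosets H)"
    (is "_ \<longleftrightarrow> ?R")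
proof -
  have mem: "C = H #> s \<longleftrightarrow> s \<in> C" if C: "C \<in> rcosets H" and s: "s \<in> carrier G" for C s
  proof -
    obtain x where "x \<in> carrier G" "C = H #> x" using C unfolding RCOSETS_def by blast
    then show ?thesis using s assms rcos_self[of s H] repr_independence[of s H x] by blast
  qed
  have "bij_betw (\<lambda>s. H #> s) S (rcosets H) \<longleftrightarrow> (\<forall>C \<in> rcosets H. \<exists>!s. s \<in> S \<inter> C)"
    if S: "S \<subseteq> carrier G"
  proof -
    have "H #> s \<in> rcosets H" if "s \<in> S" for s
      using that S rcosetsI[OF subgroup.subset[OF assms]] by blast
    note maps = this
    have "bij_betw (\<lambda>s. H #> s) S (rcosets H) \<longleftrightarrow> (\<forall>C \<in> rcosets H. \<exists>!s. s \<in> S \<and> C = H #> s)"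
      (is "?bij \<longleftrightarrow> ?ex1")
    proof
      assume ?bij
      then have "inj_on (\<lambda>s. H #> s) S" "(\<lambda>s. H #> s) ` S = rcosets H"
        by (simp_all add: bij_betw_def)
      then show ?ex1 unfolding inj_on_def by (metis (no_types, lifting) imageE)
    next
      assume ex1: ?ex1
      show ?bij
      proof (rule bij_betwI')
        show "H #> s = H #> t \<longleftrightarrow> s = t" if "s \<in> S" "t \<in> S" for s t
          using ex1 maps[OF that(1)] that by metis
      qed (use ex1 maps in auto)
    qed
    also have "\<dots> \<longleftrightarrow> (\<forall>C \<in> rcosets H. \<exists>!s. s \<in> S \<inter> C)"
      using mem S by (intro ball_cong refl arg_cong[where f = Ex1] ext) blast
    finally show ?thesis .
  qed
  then show ?thesis by (auto simp: NRT_def)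
qed

lemma NRT_exists:
  assumes H: "subgroup H G"
  shows "\<exists>S. S \<in> NRT G H"
proof -
  \<comment> \<open>The coset \<open>H\<close> must be represented by \<open>\<one>\<close>, as
    normalization demands; the other representatives are arbitrary.\<close>
  define f where "f C = (if C = H then \<one> else SOME x. x \<in> C)" for C
  have f: "f C \<in> C" if C: "C \<in> rcosets H" for C
  proof -
    obtain x where "x \<in> carrier G" "C = H #> x" using C unfolding RCOSETS_def by blast
    then have "x \<in> C" using rcos_self[OF _ H] by simp
    then have "(SOME x. x \<in> C) \<in> C" by (rule someI)
    then show ?thesis using subgroup.one_closed[OF H] by (simp add: f_def)
  qed
  have sub: "C \<subseteq> carrier G" if "C \<in> rcosets H" for C
    using that rcosets_part_G[OF H] by blast
  have Hf: "H #> f C = C" if C: "C \<in> rcosets H" for C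
  proof -
    obtain x where "x \<in> carrier G" "C = H #> x" using C unfolding RCOSETS_def by blast
    then show ?thesis using f[OF C] repr_independence[of "f C" H x] H by simp
  qed
  have "H \<in> rcosets H" using H by (simp add: subgroup.subgroup_in_rcosets is_group)
  then have "\<one> \<in> f ` (rcosets H)" by (force simp: f_def image_iff)
  moreover have "bij_betw (\<lambda>s. H #> s) (f ` (rcosets H)) (rcosets H)"
    by (rule bij_betw_byWitness[of _ f]) (auto simp: Hf)
  moreover have "f ` (rcosets H) \<subseteq> carrier G" using f sub by blast
  ultimately show ?thesis using NRT_iff[OF H] by blast
qed

text \<open>A transversal of \<open>H1 \<inter> K = H2 \<inter> K\<close> in \<open>K\<close> serves \<open>H1\<close> and \<open>H2\<close> in \<open>G\<close> simultaneously, since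
  the cardinality hypotheses say that \<open>H1 K = H2 K = G\<close>; and its loop operation only depends
  on the intersection with \<open>K\<close>.\<close>
lemma common_NRT:
  assumes fin: "finite (carrier G)"
    and H1: "subgroup H1 G" and H2: "subgroup H2 G" and K: "subgroup K G"
    and int: "H1 \<inter> K = H2 \<inter> K" and card: "card H1 = card H2"
    and full: "card H1 * card K = order G * card (H1 \<inter> K)"
  shows "\<exists>S1 \<in> NRT G H1. \<exists>S2 \<in> NRT G H2. NRT_loop G H1 S1 \<cong> NRT_loop G H2 S2"
proof -
  define D where "D = H1 \<inter> K"
  let ?K = "G\<lparr>carrier := K\<rparr>"
  interpret K: group ?K by (rule subgroup_imp_group[OF K])
  have D: "subgroup D G" unfolding D_def using H1 K subgroups_Inter_pair by blast
  then have DK: "subgroup D ?K" using K by (intro subgroup_incl) (auto simp: D_def)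
  obtain S where S: "S \<in> NRT ?K D" using K.NRT_exists[OF DK] by blast
  then have SK: "S \<subseteq> K" "\<one> \<in> S" and bij: "bij_betw (\<lambda>s. D #>\<^bsub>?K\<^esub> s) S (rcosets\<^bsub>?K\<^esub> D)"
    using K.NRT_iff[OF DK] by auto
  have SG: "S \<subseteq> carrier G" using SK K subgroup.subset by blast
  have pos: "card L > 0" if L: "subgroup L G" for L
    using finite_subset[OF subgroup.subset[OF L] fin] subgroup.one_closed[OF L]
    by (auto simp: card_gt_0_iff)
  have "card S * card D = card K"
    using bij_betw_same_card[OF bij] K.lagrange[OF DK] by (simp add: order_def)
  note cardS = this
  have NRT: "S \<in> NRT G H" if H: "subgroup H G" and HD: "H \<inter> K = D" and cH: "card H = card H1" for H
  proof -
    \<comment> \<open>Two elements of \<open>S\<close> in one coset of \<open>H\<close> differ by an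
      element of both \<open>H\<close> and \<open>K\<close>, hence of \<open>D\<close>; so they
      represent the same coset of \<open>D\<close>.\<close>
    have inj: "inj_on (\<lambda>s. H #> s) S"
    proof (rule inj_onI)
      fix s t assume st: "s \<in> S" "t \<in> S" "H #> s = H #> t"
      then have "s \<otimes> inv t \<in> H" using rcos_eq_iff[OF H] SG by blast
      moreover have "s \<otimes> inv t \<in> K"
        using st SK K by (meson subgroup.m_closed subgroup.m_inv_closed subsetD)
      ultimately have "s \<otimes> inv t \<in> D" using HD by blast
      then have "D #> s = D #> t" using rcos_eq_iff[OF D] st SG by blast
      then have "D #>\<^bsub>?K\<^esub> s = D #>\<^bsub>?K\<^esub> t" by (simp add: r_coset_def)
      then show "s = t" using bij st by (auto simp: bij_betw_def inj_on_def)
    qed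
    \<comment> \<open>\<open>S\<close> has as many elements as \<open>D\<close> has cosets in
      \<open>K\<close>. By \<open>full\<close> this is the index of \<open>H\<close> in
      \<open>G\<close>, so the injective coset map is onto.\<close>
    have "card (rcosets H) * card H = order G" by (rule lagrange[OF H])
    then have "card H * (card S * card D) = card H * (card (rcosets H) * card D)"
      using full cardS cH by (simp add: D_def mult_ac)
    then have "card S = card (rcosets H)" using pos[OF D] pos[OF H] by simp
    moreover have "(\<lambda>s. H #> s) ` S \<subseteq> rcosets H"
      using SG rcosetsI[OF subgroup.subset[OF H]] by blast
    moreover have "finite (rcosets H)"
      using fin rcosets_part_G[OF H] finite_UnionD[of "rcosets H"] by simp
    ultimately have "(\<lambda>s. H #> s) ` S = rcosets H"
      using inj by (simp add: card_subset_eq card_image)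
    then show ?thesis using NRT_iff[OF H] SG SK inj by (simp add: bij_betw_def)
  qed
  have N1: "S \<in> NRT G H1" and N2: "S \<in> NRT G H2"
    using NRT H1 H2 int card by (auto simp: D_def)
  \<comment> \<open>Whether \<open>s\<close> lies in the coset of \<open>x \<otimes> y\<close> is
    decided by \<open>s \<otimes> inv (x \<otimes> y)\<close>, an element of \<open>K\<close>, where
    \<open>H1\<close> and \<open>H2\<close> agree.\<close>
  have mult: "x \<otimes>\<^bsub>NRT_loop G H1 S\<^esub> y = x \<otimes>\<^bsub>NRT_loop G H2 S\<^esub> y" if "x \<in> S" "y \<in> S" for x y
  proof -
    have xy: "x \<otimes> y \<in> K" using that SK K by (meson subgroup.m_closed subsetD)
    have "s \<otimes> inv (x \<otimes> y) \<in> K" if "s \<in> S" for s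
      using that xy SK K by (meson subgroup.m_closed subgroup.m_inv_closed subsetD)
    then have "s \<in> H1 #> (x \<otimes> y) \<longleftrightarrow> s \<in> H2 #> (x \<otimes> y)" if "s \<in> S" for s
      using that xy SG H1 H2 int rcos_mem_iff[of _ s "x \<otimes> y"] subgroup.mem_carrier[OF K xy] by blast
    then have "S \<inter> (H1 #> (x \<otimes> y)) = S \<inter> (H2 #> (x \<otimes> y))" by blast
    then show ?thesis by (simp add: NRT_loop_def)
  qed
  have "x \<otimes>\<^bsub>NRT_loop G H1 S\<^esub> y \<in> S" if "x \<in> S" "y \<in> S" for x y
    using NRT_loop_mult[OF is_group H1 N1 that] by blast
  then have "id \<in> iso (NRT_loop G H1 S) (NRT_loop G H2 S)"
    using mult by (auto simp: iso_def hom_def NRT_loop_def)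
  then show ?thesis using N1 N2 unfolding is_iso_def by blast
qed

text \<open>Sending each coset to its representative in \<open>S\<close> is an isomorphism: the
  product of two cosets is the coset of the product of their representatives, and the representative
  of that coset is the loop product.\<close>

lemma FactGroup_iso_NRT_loop:
  assumes N: "N \<lhd> G" and S: "S \<in> NRT G N"
  shows "G Mod N \<cong> NRT_loop G N S"
proof -
  interpret N: normal N G by (rule N)
  have bij: "bij_betw (\<lambda>s. N #> s) S (rcosets N)" and SG: "S \<subseteq> carrier G"
    using S NRT_iff[OF N.is_subgroup] by auto
  define f where "f = inv_into S (\<lambda>s. N #> s)"
  have f: "f C \<in> S" "N #> f C = C" if "C \<in> rcosets N" for C
    using that bij inv_into_into[of C "\<lambda>s. N #> s" S] f_inv_into_f[of C "\<lambda>s. N #> s" S]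
    unfolding f_def bij_betw_def by simp_all
  have "f (C <#> D) = f C \<otimes>\<^bsub>NRT_loop G N S\<^esub> f D" if CD: "C \<in> rcosets N" "D \<in> rcosets N" for C D
  proof -
    have E: "C <#> D \<in> rcosets N" using CD by (rule N.setmult_closed)
    have carr: "f C \<in> carrier G" "f D \<in> carrier G" using f CD SG by blast+
    have "N #> (f C \<otimes> f D) = C <#> D"
      using f(2)[OF CD(1)] f(2)[OF CD(2)] N.rcos_sum[OF carr] by simp
    moreover have "f (C <#> D) \<in> N #> f (C <#> D)"
      using f(1)[OF E] SG by (blast intro: rcos_self N.is_subgroup)
    ultimately have "f (C <#> D) \<in> S \<inter> (N #> (f C \<otimes> f D))" using f[OF E] by simp
    then show ?thesis
      using NRT_loop_mult[OF is_group N.is_subgroup S f(1)[OF CD(1)] f(1)[OF CD(2)]] by blast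
  qed
  moreover have "bij_betw f (rcosets N) S" unfolding f_def by (rule bij_betw_inv_into[OF bij])
  ultimately have "f \<in> iso (G Mod N) (NRT_loop G N S)"
    by (auto simp: iso_def hom_def FactGroup_def NRT_loop_def f)
  then show ?thesis unfolding is_iso_def by blast
qed

end

text \<open>Each loop is a copy of the quotient group. The contrapositive refutes adjacency: normal
  subgroups with non-isomorphic quotients have no isomorphic transversals.\<close>

lemma NRT_loops_iso_imp_FactGroups_iso:
  assumes "N1 \<lhd> G" "N2 \<lhd> G" "S1 \<in> NRT G N1" "S2 \<in> NRT G N2"
    and "NRT_loop G N1 S1 \<cong> NRT_loop G N2 S2"
  shows "G Mod N1 \<cong> G Mod N2"
proof -
  have G: "group G" using assms(1) by (simp add: normal_def)
  have "G Mod N1 \<cong> NRT_loop G N2 S2"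
    using group.FactGroup_iso_NRT_loop[OF G] assms iso_trans by blast
  also have "NRT_loop G N2 S2 \<cong> G Mod N2"
    using group.FactGroup_iso_NRT_loop[OF G] assms group.iso_sym normal.factorgroup_is_group by blast
  finally show ?thesis .
qed

section \<open>Groups of order \<open>p\<^sup>2\<close>\<close>

context group
begin

lemma mult_inv_cancel:
  assumes "x \<in> carrier G" "y \<in> carrier G"
  shows "x \<otimes> (inv x \<otimes> y) = y" "inv x \<otimes> (x \<otimes> y) = y"
  using assms by (simp_all flip: m_assoc)

lemma card_subgroup_dvd:
  assumes H: "subgroup H G" and K: "subgroup K G" and "H \<subseteq> K"
  shows "card H dvd card K"
proof -
  interpret K: group "G\<lparr>carrier := K\<rparr>" by (rule subgroup_imp_group[OF K])
  have "subgroup H (G\<lparr>carrier := K\<rparr>)" using assms by (rule subgroup_incl)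
  from K.lagrange[OF this] have "card (rcosets\<^bsub>G\<lparr>carrier := K\<rparr>\<^esub> H) * card H = card K"
    by (simp add: order_def)
  then show ?thesis by (metis dvd_triv_right)
qed

text \<open>\<open>H \<inter> K\<close> contains both \<open>\<one>\<close> and \<open>x\<close>,
  and its order divides a prime, so it is all of \<open>H\<close>.\<close>

lemma prime_card_subgroup_subset:
  assumes H: "subgroup H G" and K: "subgroup K G" and p: "Factorial_Ring.prime (card H)"
    and x: "x \<in> H" "x \<in> K" "x \<noteq> \<one>"
  shows "H \<subseteq> K"
proof -
  have HK: "subgroup (H \<inter> K) G" by (rule subgroups_Inter_pair[OF H K])
  have fin: "finite H" by (rule ccontr) (use p in simp)
  have "card (H \<inter> K) dvd card H" by (rule card_subgroup_dvd[OF HK H]) simp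
  moreover have "card (H \<inter> K) \<noteq> 1"
    using x subgroup.one_closed[OF HK] by (metis IntI card_1_singletonE singletonD)
  ultimately have "card (H \<inter> K) = card H" using p prime_nat_iff by blast
  then have "H \<inter> K = H" using fin by (intro card_subset_eq) auto
  then show ?thesis by blast
qed

lemma integer_mod_group_iso_generate:
  assumes x: "x \<in> carrier G" and n: "ord x > 0"
  shows "integer_mod_group (ord x) \<cong> G\<lparr>carrier := generate G {x}\<rparr>"
proof -
  let ?n = "ord x"
  have mod: "x [^] (i mod int ?n) = x [^] i" for i :: int
    using x int_pow_eq[OF x] by (simp add: mod_eq_dvd_iff[symmetric])
  have gen: "generate G {x} = (\<lambda>i::int. x [^] i) ` {0..<int ?n}"
  proof -
    have "x [^] i \<in> (\<lambda>i::int. x [^] i) ` {0..<int ?n}" for i :: int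
      using n by (intro image_eqI[of _ _ "i mod int ?n"]) (auto simp: mod)
    then show ?thesis using generate_pow[OF x] by auto
  qed
  \<comment> \<open>The powers form a set of \<open>ord x\<close> elements, as many as there are
    exponents in the range, so no two of them coincide.\<close>
  then have "inj_on (\<lambda>i::int. x [^] i) {0..<int ?n}"
    using generate_pow_card[OF x] by (intro eq_card_imp_inj_on) auto
  then have "bij_betw (\<lambda>i::int. x [^] i) (carrier (integer_mod_group ?n)) (generate G {x})"
    using n gen by (simp add: bij_betw_def carrier_integer_mod_group)
  moreover have "(\<lambda>i::int. x [^] i) \<in> hom (integer_mod_group ?n) (G\<lparr>carrier := generate G {x}\<rparr>)"
    using x generate_pow[OF x] by (intro homI) (auto simp: mod int_pow_mult)
  ultimately show ?thesis by (auto simp: is_iso_def iso_def)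
qed

text \<open>The order divides \<open>p ^ 2\<close>. It is not \<open>1\<close>, since the subgroup
  contains \<open>x\<close> besides \<open>\<one>\<close>, and not \<open>p ^ 2\<close>, since the
  subgroup is proper.\<close>

lemma generate_psquare:
  assumes p: "Factorial_Ring.prime p" and order: "order G = p ^ 2"
    and x: "x \<in> carrier G" "x \<noteq> \<one>" and "generate G {x} \<noteq> carrier G"
  shows "card (generate G {x}) = p"
proof -
  have fin: "finite (carrier G)"
    using order p by (metis order_gt_0_iff_finite prime_gt_0_nat zero_less_power)
  have sub: "subgroup (generate G {x}) G" using x by (simp add: generate_is_subgroup)
  obtain i where i: "i \<le> 2" "card (generate G {x}) = p ^ i"
    using card_subgroup_dvd[OF sub subgroup_self] subgroup.subset[OF sub] order p
    by (auto simp: order_def divides_primepow_nat)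
  have "i \<noteq> 0"
  proof
    assume "i = 0"
    then have "card (generate G {x}) = 1" using i by simp
    moreover have "x \<in> generate G {x}" by (simp add: generate.incl)
    moreover have "\<one> \<in> generate G {x}" by (rule generate.one)
    ultimately show False using x by (metis card_1_singletonE singletonD)
  qed
  moreover have "i \<noteq> 2"
  proof
    assume "i = 2"
    then have "card (generate G {x}) = card (carrier G)" using i order by (simp add: order_def)
    then show False using assms(5) fin subgroup.subset[OF sub] card_subset_eq by blast
  qed
  ultimately have "i = 1" using i by simp
  then show ?thesis using i by simp
qed

text \<open>If \<open>A\<close> and \<open>g\<^sup>-\<^sup>1 A g\<close> meet trivially, then \<open>(h, k) \<mapsto> h g\<^sup>-\<^sup>1 k\<close> is injective on \<open>A \<times> A\<close>, hence
  takes the value \<open>1\<close>, which puts \<open>g\<close> into \<open>A\<close>.\<close>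
lemma prime_subgroup_normal_psquare:
  assumes p: "Factorial_Ring.prime p" and order: "order G = p ^ 2"
    and A: "subgroup A G" "card A = p"
  shows "A \<lhd> G"
proof (rule normal_invI[OF A(1)])
  have fin: "finite (carrier G)"
    using order p by (metis order_gt_0_iff_finite prime_gt_0_nat zero_less_power)
  interpret A: subgroup A G by (rule A(1))
  fix g a assume g: "g \<in> carrier G" and a: "a \<in> A"
  show "g \<otimes> a \<otimes> inv g \<in> A"
  proof (cases "g \<in> A")
    case True
    then show ?thesis using a by simp
  next
    case False
    define f where "f = (\<lambda>(h, k). h \<otimes> inv g \<otimes> k)"
    \<comment> \<open>\<open>B\<close> is the conjugate \<open>g\<^sup>-\<^sup>1 A g\<close>. A
      nontrivial element of \<open>A \<inter> B\<close> will come from a collision of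
      \<open>f\<close>.\<close>
    define B where "B = {b \<in> carrier G. g \<otimes> b \<otimes> inv g \<in> A}"
    \<comment> \<open>The value \<open>\<one>\<close> would put \<open>g\<close> into
      \<open>A\<close>. So \<open>f\<close> takes fewer than \<open>p ^ 2\<close> values on the
      \<open>p ^ 2\<close> pairs and has a collision.\<close>
    have "\<one> \<noteq> f (h, k)" if "h \<in> A" "k \<in> A" for h k
    proof
      assume "\<one> = f (h, k)"
      then have "h \<otimes> (inv g \<otimes> k) = \<one>" using that g by (simp add: f_def m_assoc)
      then have "inv g \<otimes> k = inv h"
        using that g inv_unique' by (metis A.mem_carrier inv_closed inv_equality inv_inv m_closed)
      then have "k = g \<otimes> inv h" using that g by (simp add: inv_solve_left')
      then have "g = k \<otimes> h" using that g by (simp add: m_assoc)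
      then show False using that False by simp
    qed
    then have "f ` (A \<times> A) \<subseteq> carrier G - {\<one>}"
      using g by (fastforce simp: f_def)
    then have "card (f ` (A \<times> A)) < card (carrier G)"
      using fin one_closed by (intro psubset_card_mono) blast+
    then have "card (f ` (A \<times> A)) \<noteq> card (A \<times> A)"
      using order A(2) by (simp add: order_def card_cartesian_product power2_eq_square)
    then have "\<not> inj_on f (A \<times> A)" using card_image by blast
    then obtain h k h' k' where hk: "h \<in> A" "k \<in> A" "h' \<in> A" "k' \<in> A"
      and eq: "f (h, k) = f (h', k')" and ne: "(h, k) \<noteq> (h', k')"
      unfolding inj_on_def by blast
    \<comment> \<open>The collision says that conjugating \<open>u\<close> by \<open>g\<close> gives
      \<open>k' \<otimes> inv k\<close>, an element of \<open>A\<close>; so \<open>u\<close> lies in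
      both \<open>A\<close> and \<open>B\<close>.\<close>
    define u where "u = inv h' \<otimes> h"
    have uA: "u \<in> A" using hk by (simp add: u_def)
    have "h \<otimes> inv g \<otimes> k \<otimes> inv k = h' \<otimes> inv g \<otimes> k' \<otimes> inv k" using eq by (simp add: f_def)
    then have "inv h' \<otimes> (h \<otimes> inv g) = inv h' \<otimes> (h' \<otimes> (inv g \<otimes> (k' \<otimes> inv k)))"
      using hk g by (simp add: m_assoc)
    then have "g \<otimes> (inv h' \<otimes> (h \<otimes> inv g)) = k' \<otimes> inv k"
      using hk g by (simp add: mult_inv_cancel)
    then have conj: "g \<otimes> u \<otimes> inv g = k' \<otimes> inv k"
      using hk g by (simp add: u_def m_assoc)
    have "u \<noteq> \<one>"
    proof
      assume u: "u = \<one>"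
      then have "h = h'" using hk by (simp add: u_def inv_solve_left')
      moreover have "k' \<otimes> inv k \<otimes> k = k" using conj u hk g by simp
      then have "k' = k" using hk by (simp add: m_assoc)
      ultimately show False using ne by simp
    qed
    moreover have "subgroup B G"
    proof
      fix x y assume xy: "x \<in> B" "y \<in> B"
      have "g \<otimes> (x \<otimes> y) \<otimes> inv g = (g \<otimes> x \<otimes> inv g) \<otimes> (g \<otimes> y \<otimes> inv g)"
        using xy g by (simp add: B_def m_assoc mult_inv_cancel)
      also have "\<dots> \<in> A" using xy by (simp add: B_def)
      finally show "x \<otimes> y \<in> B" using xy by (simp add: B_def)
    next
      fix x assume x: "x \<in> B"
      have "g \<otimes> inv x \<otimes> inv g = inv (g \<otimes> x \<otimes> inv g)"
        using x g by (simp add: B_def m_assoc inv_mult_group)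
      also have "\<dots> \<in> A" using x by (simp add: B_def)
      finally show "inv x \<in> B" using x by (simp add: B_def)
    qed (use g in \<open>auto simp: B_def\<close>)
    moreover have "u \<in> B" using uA conj hk by (simp add: B_def)
    ultimately have "A \<subseteq> B" using prime_card_subgroup_subset[OF A(1), of B u] uA p A(2) by blast
    then show ?thesis using a by (auto simp: B_def)
  qed
qed

text \<open>Either one of two elements is a power of the other, or they generate normal subgroups of
  order \<open>p\<close> with trivial intersection, and such subgroups centralize each
  other.\<close>

lemma psquare_comm_group:
  assumes p: "Factorial_Ring.prime p" and order: "order G = p ^ 2"
  shows "comm_group G"
proof (rule group_comm_groupI)
  have self: "x \<otimes> y = y \<otimes> x" if "x \<in> carrier G" "y \<in> generate G {x}" for x y
    using that generate_pow[of x] int_pow_mult[of x 1] int_pow_mult[of x _ 1]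
    by (auto simp: add.commute)
  fix x y assume xy: "x \<in> carrier G" "y \<in> carrier G"
  let ?A = "generate G {x}" and ?B = "generate G {y}"
  have mem: "x \<in> ?A" "y \<in> ?B" by (auto intro: generate.incl)
  have sub: "subgroup ?A G" "subgroup ?B G" using xy by (simp_all add: generate_is_subgroup)
  show "x \<otimes> y = y \<otimes> x"
  proof (cases "y \<in> ?A \<or> x \<in> ?B")
    case True
    then show ?thesis using self xy by metis
  next
    case False
    then have ne: "x \<noteq> \<one>" "y \<noteq> \<one>" "?A \<noteq> carrier G" "?B \<noteq> carrier G"
      using xy generate.one by blast+
    then have card: "card ?A = p" "card ?B = p" using generate_psquare[OF p order] xy by blast+
    then have "?A \<lhd> G" "?B \<lhd> G" using prime_subgroup_normal_psquare[OF p order] sub by blast+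
    moreover have "?A \<inter> ?B \<subseteq> {\<one>}"
      using prime_card_subgroup_subset[OF sub(1) sub(2)] p card mem False by auto
    ultimately show ?thesis using normal_imp_commuting mem by metis
  qed
qed

text \<open>If no element generates the group, then two cyclic subgroups of order \<open>p\<close>
  that meet trivially yield \<open>p ^ 2\<close> products, so the group is their internal direct
  product.\<close>

lemma psquare_iso:
  assumes p: "Factorial_Ring.prime p" and order: "order G = p ^ 2"
  shows "integer_mod_group (p ^ 2) \<cong> G \<or> integer_mod_group p \<times>\<times> integer_mod_group p \<cong> G"
proof (cases "\<exists>x \<in> carrier G. generate G {x} = carrier G")
  case True
  obtain x where x: "x \<in> carrier G" "generate G {x} = carrier G" using True by blast
  then have "ord x = p ^ 2" using generate_pow_card order by (simp add: order_def)
  then show ?thesis using integer_mod_group_iso_generate[OF x(1)] x(2) p by (simp add: prime_gt_0_nat)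
next
  case False
  have fin: "finite (carrier G)"
    using order p by (metis order_gt_0_iff_finite prime_gt_0_nat zero_less_power)
  have "carrier G \<noteq> {\<one>}"
  proof
    assume "carrier G = {\<one>}"
    then have "p ^ 2 = 1" using order by (simp add: order_def)
    then show False using p by simp
  qed
  then obtain x where x: "x \<in> carrier G" "x \<noteq> \<one>" using one_closed by blast
  let ?A = "generate G {x}"
  have subA: "subgroup ?A G" using x by (simp add: generate_is_subgroup)
  have "?A \<noteq> carrier G" using False x by blast
  then obtain y where y: "y \<in> carrier G" "y \<notin> ?A" using subgroup.subset[OF subA] by blast
  let ?B = "generate G {y}"
  have subB: "subgroup ?B G" using y by (simp add: generate_is_subgroup)
  have "y \<noteq> \<one>" using y generate.one by blast
  then have card: "card ?A = p" "card ?B = p"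
    using generate_psquare[OF p order] x y False by blast+
  have int: "?B \<inter> ?A \<subseteq> {\<one>}"
    using prime_card_subgroup_subset[OF subB subA] p card y generate.incl[of y "{y}" G] by auto
  interpret group_disjoint_sum G ?A ?B
    using subA subB by (simp add: group_disjoint_sum_def is_group)
  have inj: "inj_on (\<lambda>(u, v). u \<otimes> v) (?A \<times> ?B)"
    using int cancel by (auto simp: inj_on_def Int_commute)
  have "?A <#> ?B = (\<lambda>(u, v). u \<otimes> v) ` (?A \<times> ?B)" by (auto simp: set_mult_def)
  then have "card (?A <#> ?B) = card (carrier G)"
    using card_image[OF inj] card order by (simp add: card_cartesian_product order_def power2_eq_square)
  moreover have "?A <#> ?B \<subseteq> carrier G"
    using set_mult_closed subgroup.subset[OF subA] subgroup.subset[OF subB] by blast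
  ultimately have "?A <#> ?B = carrier G" using fin card_subset_eq by blast
  then have iso: "subgroup_generated G ?A \<times>\<times> subgroup_generated G ?B \<cong> G"
    using iso_group_mul[OF psquare_comm_group[OF p order]] int unfolding is_iso_def by blast
  have cyc: "integer_mod_group p \<cong> subgroup_generated G (generate G {z})"
    if z: "z \<in> carrier G" "card (generate G {z}) = p" for z
  proof -
    have "integer_mod_group p \<cong> G\<lparr>carrier := generate G {z}\<rparr>"
      using integer_mod_group_iso_generate[OF z(1)] generate_pow_card[OF z(1)] z(2) p
      by (simp add: prime_gt_0_nat)
    moreover have "subgroup_generated G (generate G {z}) = G\<lparr>carrier := generate G {z}\<rparr>"
      using subgroup.carrier_subgroup_generated_subgroup[OF generate_is_subgroup[of "{z}"]] z(1)
      by (simp add: subgroup_generated_def)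
    ultimately show ?thesis by simp
  qed
  have "integer_mod_group p \<times>\<times> integer_mod_group p \<cong> subgroup_generated G ?A \<times>\<times> subgroup_generated G ?B"
    using cyc[OF x(1) card(1)] cyc[OF y(1) card(2)] group.DirProd_iso_trans[OF group_integer_mod_group] by blast
  then show ?thesis using iso iso_trans by blast
qed

end

section \<open>Subgroups of prime order avoiding two given ones\<close>

context group
begin

lemma pow_card_subgroup:
  assumes H: "subgroup H G" and x: "x \<in> H"
  shows "x [^] card H = \<one>"
proof -
  interpret H: group "G\<lparr>carrier := H\<rparr>" by (rule subgroup_imp_group[OF H])
  show ?thesis using H.pow_order_eq_1[of x] x by (simp add: order_def flip: nat_pow_consistent)
qed

text \<open>The product of nontrivial elements of \<open>L1\<close> and \<open>L2\<close> generates a third subgroup.\<close>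
lemma common_complement:
  assumes L1: "subgroup L1 G" "card L1 = p" and L2: "subgroup L2 G" "card L2 = p"
    and p: "Factorial_Ring.prime p" and ne: "L1 \<noteq> L2"
    and comm: "\<And>x y. x \<in> L1 \<Longrightarrow> y \<in> L2 \<Longrightarrow> x \<otimes> y = y \<otimes> x"
    and P: "subgroup P G" "L1 \<subseteq> P" "L2 \<subseteq> P"
  obtains M where "subgroup M G" "M \<subseteq> P" "card M = p" "L1 \<inter> M = {\<one>}" "L2 \<inter> M = {\<one>}"
proof -
  interpret L1: subgroup L1 G by (rule L1(1))
  interpret L2: subgroup L2 G by (rule L2(1))
  have ex: "\<exists>x \<in> L. x \<noteq> \<one>" if "card L = p" for L
  proof (rule ccontr)
    assume "\<not> ?thesis"
    then have "L \<subseteq> {\<one>}" by blast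
    then have "card L \<le> 1" using card_mono[of "{\<one>}" L] by simp
    then show False using that prime_gt_1_nat[OF p] by simp
  qed
  obtain a where a: "a \<in> L1" "a \<noteq> \<one>" using ex L1 by blast
  obtain b where b: "b \<in> L2" "b \<noteq> \<one>" using ex L2 by blast
  have fin: "finite L1" "finite L2" 
    using L1(2) L2(2) prime_gt_0_nat[OF p] by (simp_all add: card_ge_0_finite)
  \<comment> \<open>Otherwise \<open>L2\<close>, being of prime order, would be contained in
    \<open>L1\<close> and then equal to it.\<close>
  have b1: "b \<notin> L1"
    using prime_card_subgroup_subset[OF L2(1) L1(1), of b] card_subset_eq[of L1 L2] b L1(2) L2(2) p ne fin
    by auto
  have a2: "a \<notin> L2"
    using prime_card_subgroup_subset[OF L1(1) L2(1), of a] card_subset_eq[of L2 L1] a L1(2) L2(2) p ne fin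
    by auto
  define M where "M = generate G {a \<otimes> b}"
  have carr: "a \<in> carrier G" "b \<in> carrier G" using a b by auto
  have M: "subgroup M G" using carr by (simp add: M_def generate_is_subgroup)
  have ab: "a \<otimes> b \<in> M" by (simp add: M_def generate.incl)
  have ab1: "a \<otimes> b \<notin> L1"
  proof
    assume "a \<otimes> b \<in> L1"
    then have "inv a \<otimes> (a \<otimes> b) \<in> L1" using a by simp
    then show False using b1 carr by (simp add: mult_inv_cancel)
  qed
  have ab2: "a \<otimes> b \<notin> L2"
  proof
    assume "a \<otimes> b \<in> L2"
    then have "(a \<otimes> b) \<otimes> inv b \<in> L2" using b by simp
    then show False using a2 carr by (simp add: m_assoc)
  qed
  \<comment> \<open>As \<open>a\<close> and \<open>b\<close> commute, the order of
    \<open>a \<otimes> b\<close> divides \<open>p\<close>; it is not \<open>1\<close> because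
    \<open>a \<otimes> b\<close> is outside \<open>L1\<close>.\<close>
  have "(a \<otimes> b) [^] p = a [^] p \<otimes> b [^] p"
    using comm[OF a(1) b(1)] carr by (rule pow_mult_distrib)
  also have "\<dots> = \<one>"
    using pow_card_subgroup[OF L1(1) a(1)] pow_card_subgroup[OF L2(1) b(1)] L1 L2 by simp
  finally have "ord (a \<otimes> b) dvd p" using carr by (simp add: pow_eq_id)
  moreover have "ord (a \<otimes> b) \<noteq> 1" using ab1 carr ord_eq_1[of "a \<otimes> b"] by auto
  ultimately have "ord (a \<otimes> b) = p" using p prime_nat_iff by blast
  then have cardM: "card M = p" using generate_pow_card[of "a \<otimes> b"] carr by (simp add: M_def)
  \<comment> \<open>A nontrivial common element would put all of \<open>M\<close>, including its
    generator, into \<open>L1\<close>.\<close>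
  have "L1 \<inter> M = {\<one>}"
    using prime_card_subgroup_subset[OF M L1(1)] cardM p ab ab1 subgroup.one_closed[OF M] by auto
  moreover have "L2 \<inter> M = {\<one>}"
    using prime_card_subgroup_subset[OF M L2(1)] cardM p ab ab2 subgroup.one_closed[OF M] by auto
  moreover have "M \<subseteq> P"
    using generate_subgroup_incl[OF _ P(1), of "{a \<otimes> b}"] a b P subgroup.m_closed[OF P(1)]
    unfolding M_def by blast
  ultimately show thesis using that M cardM by blast
qed

end

section \<open>Extensions of a subgroup by an involution\<close>

text \<open>\<open>P\<close> has index two and is therefore normal, so \<open>G\<close> is the
  internal semidirect product of \<open>P\<close> and the subgroup
  \<open>{\<one>, c}\<close>.\<close>

locale involution_extension = group G for G (structure) +
  fixes P :: "'a set" and c :: 'a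
  assumes P: "subgroup P G"
    and c: "c \<in> carrier G" "c \<notin> P" "c \<otimes> c = \<one>"
    and carrier_eq: "carrier G = P \<union> (P #> c)"
begin

sublocale P: subgroup P G by (rule P)

lemma c_c_mult: "y \<in> carrier G \<Longrightarrow> c \<otimes> (c \<otimes> y) = y"
  using c by (simp flip: m_assoc)

lemma not_P_E:
  assumes "x \<in> carrier G" "x \<notin> P"
  obtains y where "y \<in> P" "x = y \<otimes> c"
  using assms carrier_eq by (auto simp: r_coset_def)

end

subsection \<open>The involution inverts the subgroup\<close>

text \<open>These are the generalized dihedral groups: \<open>P\<close> consists of the rotations,
  and its complement of the reflections. Commutativity of \<open>P\<close> is derived in
  \<open>P_comm\<close>.\<close>

locale inverting_involution = involution_extension +
  assumes inversion: "x \<in> P \<Longrightarrow> c \<otimes> x \<otimes> c = inv x"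
begin

text \<open>As rewrite rules, this and \<open>c_mult'\<close> move \<open>c\<close> to the right
  past elements of \<open>P\<close>, which brings products into the form \<open>y\<close> or
  \<open>y \<otimes> c\<close> with \<open>y\<close> in \<open>P\<close>.\<close>

lemma c_mult: "x \<in> P \<Longrightarrow> c \<otimes> x = inv x \<otimes> c"
proof -
  assume x: "x \<in> P"
  have "c \<otimes> x = c \<otimes> x \<otimes> (c \<otimes> c)" using x c by simp
  also have "\<dots> = (c \<otimes> x \<otimes> c) \<otimes> c" using x c by (simp add: m_assoc del: c)
  finally show ?thesis using inversion x by simp
qed

lemma c_mult': "x \<in> P \<Longrightarrow> y \<in> carrier G \<Longrightarrow> c \<otimes> (x \<otimes> y) = inv x \<otimes> (c \<otimes> y)"
  using c_mult[of x] c(1) by (simp flip: m_assoc)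

text \<open>Conjugation by \<open>c\<close> is a homomorphism, and inversion is one only on an
  abelian group. Moving \<open>c\<close> past \<open>y \<otimes> x\<close> at once or factor by
  factor gives the two sides.\<close>

lemma P_comm:
  assumes "x \<in> P" "y \<in> P"
  shows "x \<otimes> y = y \<otimes> x"
proof -
  have "inv (y \<otimes> x) \<otimes> c = c \<otimes> (y \<otimes> x)" using assms c_mult by simp
  also have "\<dots> = inv y \<otimes> (c \<otimes> x)" using assms by (intro c_mult') auto
  also have "\<dots> = inv y \<otimes> inv x \<otimes> c" using assms c(1) by (simp add: c_mult m_assoc)
  also have "\<dots> = inv (x \<otimes> y) \<otimes> c" using assms by (simp add: inv_mult_group)
  finally have "inv (y \<otimes> x) = inv (x \<otimes> y)" using assms c by simp
  then show ?thesis using assms by (metis P.mem_carrier inv_inv m_closed)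
qed

lemma square_outside_P:
  assumes "x \<in> carrier G" "x \<notin> P"
  shows "x \<otimes> x = \<one>"
proof -
  obtain y where "y \<in> P" "x = y \<otimes> c" using not_P_E assms by blast
  then show ?thesis using c by (simp add: m_assoc c_mult' mult_inv_cancel)
qed

text \<open>An element outside \<open>P\<close> is an involution, but an element with
  \<open>x\<^sup>2 = \<one>\<close> equals its own odd power \<open>x [^] card H\<close>, which is
  \<open>\<one>\<close>.\<close>

lemma odd_subgroup_subset:
  assumes H: "subgroup H G" and odd: "odd (card H)"
  shows "H \<subseteq> P"
proof
  fix x assume x: "x \<in> H"
  then have xG: "x \<in> carrier G" using H subgroup.mem_carrier by metis
  show "x \<in> P"
  proof (rule ccontr)
    assume xP: "x \<notin> P"
    obtain k where k: "card H = 2 * k + 1" using odd oddE by blast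
    have "x [^] (2::nat) = \<one>" using square_outside_P[OF xG xP] xG by (simp add: numeral_2_eq_2)
    then have "x [^] (2 * k + 1) = x"
      using xG by (simp add: nat_pow_pow[symmetric])
    then show False using pow_card_subgroup[OF H x] k xP by simp
  qed
qed

text \<open>Right multiplication by an element \<open>h\<close> of \<open>H\<close> outside
  \<open>P\<close> exchanges \<open>H \<inter> P\<close> and \<open>H - P\<close>; it undoes itself
  because \<open>h\<close> squares to \<open>\<one>\<close>.\<close>

lemma card_subgroup_not_subset:
  assumes H: "subgroup H G" "\<not> H \<subseteq> P" and fin: "finite (carrier G)"
  shows "card H = 2 * card (H \<inter> P)"
proof -
  interpret H: subgroup H G by (rule H(1))
  obtain h where h: "h \<in> H" "h \<notin> P" using H by blast
  have hc: "h \<in> carrier G" using h by simp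
  obtain y where y: "y \<in> P" "h = y \<otimes> c" using not_P_E[OF hc h(2)] by blast
  have "H - P = (\<lambda>x. x \<otimes> h) ` (H \<inter> P)"
  proof (intro equalityI subsetI)
    fix x assume x: "x \<in> H - P"
    then obtain z where z: "z \<in> P" "x = z \<otimes> c" using not_P_E[of x] by auto
    have "x \<otimes> h = z \<otimes> inv y" using y z c by (simp add: m_assoc c_mult')
    then have "x \<otimes> h \<in> H \<inter> P" using x h y z H.m_closed[of x h] by simp
    moreover have "x = x \<otimes> h \<otimes> h" using x hc square_outside_P[OF hc h(2)] by (simp add: m_assoc)
    ultimately show "x \<in> (\<lambda>x. x \<otimes> h) ` (H \<inter> P)" by blast
  next
    fix x assume "x \<in> (\<lambda>x. x \<otimes> h) ` (H \<inter> P)"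
    then obtain z where z: "z \<in> H" "z \<in> P" "x = z \<otimes> h" by blast
    have "x \<notin> P"
    proof
      assume "x \<in> P"
      then have "inv z \<otimes> x \<in> P" using z by simp
      then show False using z h hc by (simp add: mult_inv_cancel)
    qed
    then show "x \<in> H - P" using z h by simp
  qed
  moreover have "inj_on (\<lambda>x. x \<otimes> h) (H \<inter> P)" using hc by (auto simp: inj_on_def)
  ultimately have "card (H - P) = card (H \<inter> P)" by (simp add: card_image)
  moreover have "finite H" by (rule finite_subset[OF H.subset fin])
  ultimately show ?thesis using card_Int_Diff[of H P] by simp
qed

lemma order_eq: "finite (carrier G) \<Longrightarrow> order G = 2 * card P"
  using card_subgroup_not_subset[OF subgroup_self] c P.subset by (auto simp: order_def Int_absorb1)

text \<open>Inversion preserves every subgroup \<open>M\<close> of \<open>P\<close>, so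
  \<open>c\<close> normalizes \<open>M\<close> and the union is the product of \<open>M\<close> with
  \<open>{\<one>, c}\<close>.\<close>

lemma subgroup_Un_coset:
  assumes M: "subgroup M G" "M \<subseteq> P"
  shows "subgroup (M \<union> (M #> c)) G"
proof -
  interpret M: subgroup M G by (rule M(1))
  have P: "x \<in> P" if "x \<in> M" for x using that M by blast
  have mem: "x \<otimes> c \<in> M #> c" if "x \<in> M" for x using that by (auto simp: r_coset_def)
  show ?thesis
  proof
    show "M \<union> (M #> c) \<subseteq> carrier G" using c by (auto simp: r_coset_def)
    show "\<one> \<in> M \<union> (M #> c)" by simp
  next
    fix x y assume "x \<in> M \<union> (M #> c)" "y \<in> M \<union> (M #> c)"
    moreover have "u \<otimes> (v \<otimes> c) = (u \<otimes> v) \<otimes> c" "u \<otimes> c \<otimes> v = (u \<otimes> inv v) \<otimes> c"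
      "u \<otimes> c \<otimes> (v \<otimes> c) = u \<otimes> inv v" if "u \<in> M" "v \<in> M" for u v
      using that c P by (simp_all add: m_assoc c_mult' c_mult)
    ultimately show "x \<otimes> y \<in> M \<union> (M #> c)" using mem by (auto simp: r_coset_def)
  next
    fix x assume x: "x \<in> M \<union> (M #> c)"
    show "inv x \<in> M \<union> (M #> c)"
    proof (cases "x \<in> M")
      case False
      then obtain u where u: "u \<in> M" "x = u \<otimes> c" using x by (auto simp: r_coset_def)
      have "x \<otimes> x = \<one>" using u c P by (simp add: m_assoc c_mult' mult_inv_cancel)
      then have "inv x = x" using u c by (simp add: inv_equality)
      then show ?thesis using x by simp
    qed simp
  qed
qed

theorem t_group_psquare:
  assumes p: "Factorial_Ring.prime p" "odd p" and fin: "finite (carrier G)" and card: "card P = p ^ 2"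
  shows "t_group G"
proof -
  have order: "order G = 2 * p ^ 2" using order_eq[OF fin] card by simp
  have finP: "finite P" by (rule finite_subset[OF P.subset fin])
  have sub_P: "card H \<in> {1, p, p ^ 2} \<and> odd (card H)" if H: "subgroup H G" "H \<subseteq> P" for H
  proof -
    have "card H dvd p ^ 2" using card_subgroup_dvd[OF H(1) P H(2)] card by simp
    then obtain i where i: "i \<le> 2" "card H = p ^ i" using p divides_primepow_nat by blast
    then have "i = 0 \<or> i = 1 \<or> i = 2" by linarith
    then show ?thesis using i p by auto
  qed
  have trivial: "H = {\<one>}" if "subgroup H G" "card H = 1" for H
    using that subgroup.one_closed by (metis card_1_singletonE singletonD)
  have eqP: "H = P" if "H \<subseteq> P" "card H = p ^ 2" for H
    using that card finP card_subset_eq by metis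
  have "\<exists>S1 \<in> NRT G H1. \<exists>S2 \<in> NRT G H2. NRT_loop G H1 S1 \<cong> NRT_loop G H2 S2"
    if H1: "subgroup H1 G" and H2: "subgroup H2 G" and eq: "card H1 = card H2" and ne: "H1 \<noteq> H2"
    for H1 H2
  proof (cases "H1 \<subseteq> P")
    case True
    \<comment> \<open>The common order is odd, so the second subgroup lies in \<open>P\<close> as
      well.\<close>
    then have sub: "H1 \<subseteq> P" "H2 \<subseteq> P" using sub_P[OF H1] eq odd_subgroup_subset[OF H2] by auto
    \<comment> \<open>\<open>P\<close> has only one subgroup of order \<open>1\<close> and only one
      of order \<open>p ^ 2\<close>, so distinct ones must have order \<open>p\<close>.\<close>
    have "card H1 \<noteq> 1" using trivial H1 H2 eq ne by metis
    moreover have "card H1 \<noteq> p ^ 2" using eqP sub eq ne by metis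
    ultimately have card_p: "card H1 = p" "card H2 = p" using sub_P[OF H1 sub(1)] eq by auto
    obtain M where M: "subgroup M G" "M \<subseteq> P" "card M = p" "H1 \<inter> M = {\<one>}" "H2 \<inter> M = {\<one>}"
    proof (rule common_complement[OF H1 card_p(1) H2 card_p(2) p(1) ne _ P sub])
      fix x y assume "x \<in> H1" "y \<in> H2"
      then show "x \<otimes> y = y \<otimes> x" using sub P_comm by blast
    qed
    \<comment> \<open>\<open>M\<close> alone is too small here: \<open>H1\<close> has order
      \<open>p\<close>, so a subgroup meeting it trivially must have order \<open>2 * p\<close> to
      have full product with it.\<close>
    define K where "K = M \<union> (M #> c)"
    have K: "subgroup K G" unfolding K_def by (rule subgroup_Un_coset[OF M(1,2)])
    have "c \<in> K" using c rcos_self[OF c(1) M(1)] by (simp add: K_def)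
    then have "\<not> K \<subseteq> P" using c by blast
    moreover have KP: "K \<inter> P = M"
    proof -
      have "x \<otimes> c \<notin> P" if "x \<in> M" for x
      proof
        assume "x \<otimes> c \<in> P"
        then have "inv x \<otimes> (x \<otimes> c) \<in> P" using that M(2) by blast
        then show False using that M(2) c by (simp add: mult_inv_cancel subset_iff)
      qed
      then show ?thesis using M(2) by (auto simp: K_def r_coset_def)
    qed
    ultimately have cardK: "card K = 2 * p" using card_subgroup_not_subset[OF K _ fin] M(3) by simp
    have int: "H1 \<inter> K = {\<one>}" "H2 \<inter> K = {\<one>}" using M(4,5) KP sub by blast+
    show ?thesis
      by (rule common_NRT[OF fin H1 H2 K])
        (use int eq card_p cardK order in \<open>auto simp: power2_eq_square\<close>)
  next
    case False
    then have card1: "card H1 = 2 * card (H1 \<inter> P)" using card_subgroup_not_subset[OF H1 _ fin] by simp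
    \<comment> \<open>The common order is even, while subgroups of \<open>P\<close> have odd
      order.\<close>
    then have "\<not> H2 \<subseteq> P" using sub_P[OF H2] eq by auto
    then have card2: "card H2 = 2 * card (H2 \<inter> P)" using card_subgroup_not_subset[OF H2 _ fin] by simp
    have sub: "subgroup (H1 \<inter> P) G" "subgroup (H2 \<inter> P) G"
      by (rule subgroups_Inter_pair[OF H1 P], rule subgroups_Inter_pair[OF H2 P])
    show ?thesis
    proof (cases "H1 \<inter> P = H2 \<inter> P")
      case True
      \<comment> \<open>\<open>K = P\<close> has full product with \<open>H1\<close>, because
        \<open>H1\<close> has twice the order of \<open>H1 \<inter> P\<close> and \<open>G\<close>
        twice that of \<open>P\<close>.\<close>
      show ?thesis
        by (rule common_NRT[OF fin H1 H2 P]) (use True eq card1 card order in auto)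
    next
      case ne: False
      have eqi: "card (H1 \<inter> P) = card (H2 \<inter> P)" using card1 card2 eq by simp
      have "card (H1 \<inter> P) \<noteq> 1" using trivial sub eqi ne by metis
      moreover have "card (H1 \<inter> P) \<noteq> p ^ 2" using eqP eqi ne by (metis Int_lower2)
      ultimately have card_p: "card (H1 \<inter> P) = p" "card (H2 \<inter> P) = p"
        using sub_P[OF sub(1)] eqi by auto
      obtain M where M: "subgroup M G" "M \<subseteq> P" "card M = p"
        "H1 \<inter> P \<inter> M = {\<one>}" "H2 \<inter> P \<inter> M = {\<one>}"
      proof (rule common_complement[OF sub(1) card_p(1) sub(2) card_p(2) p(1) ne _ P])
        fix x y assume "x \<in> H1 \<inter> P" "y \<in> H2 \<inter> P"
        then show "x \<otimes> y = y \<otimes> x" using P_comm by blast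
      qed auto
      then have int: "H1 \<inter> M = {\<one>}" "H2 \<inter> M = {\<one>}" by blast+
      \<comment> \<open>Both subgroups have order \<open>2 * p\<close> and meet \<open>M\<close>, of
        order \<open>p\<close>, trivially; so \<open>K = M\<close> already has full product with
        them.\<close>
      show ?thesis
        by (rule common_NRT[OF fin H1 H2 M(1)])
          (use int eq card1 card_p M(3) order in \<open>auto simp: power2_eq_square\<close>)
    qed
  qed
  then show ?thesis unfolding t_group_iff using fin is_group by blast
qed

end

section \<open>Recognition and transport of generalized dihedral groups\<close>

context inverting_involution
begin

text \<open>The isomorphism extends \<open>\<psi>\<close> by sending \<open>(x, 1)\<close> to
  \<open>\<psi> x \<otimes> c\<close>. It respects products because \<open>c\<close> inverts
  \<open>P\<close> exactly as the second component inverts \<open>A\<close>.\<close>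

lemma generalized_dihedral_group_iso:
  assumes A: "comm_group A" and iso: "A \<cong> G\<lparr>carrier := P\<rparr>"
  shows "generalized_dihedral_group A \<cong> G"
proof -
  interpret A: comm_group A by (rule A)
  interpret PG: group "G\<lparr>carrier := P\<rparr>" by (rule subgroup_imp_group[OF P])
  obtain \<psi> where \<psi>: "\<psi> \<in> hom A (G\<lparr>carrier := P\<rparr>)" "bij_betw \<psi> (carrier A) P"
    using iso by (auto simp: is_iso_def iso_def)
  interpret \<psi>: group_hom A "G\<lparr>carrier := P\<rparr>" \<psi>
    by (simp add: group_hom_def group_hom_axioms_def \<psi> A.is_group PG.is_group)
  have \<psi>_mult: "\<psi> (x \<otimes>\<^bsub>A\<^esub> y) = \<psi> x \<otimes> \<psi> y" if "x \<in> carrier A" "y \<in> carrier A" for x y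
    using \<psi>.hom_mult[OF that] by simp
  have \<psi>_P: "\<psi> x \<in> P" if "x \<in> carrier A" for x using \<psi>.hom_closed[OF that] by simp
  let ?D = "generalized_dihedral_group A"
  have carrier: "carrier ?D = carrier A \<times> {0, 1}"
    by (auto simp: generalized_dihedral_group_def semidirect_product_def carrier_integer_mod_group)
  define f where "f = (\<lambda>(x, k::int). \<psi> x \<otimes> (if k = 0 then \<one> else c))"
  have "f \<in> hom ?D G"
  proof (rule homI)
    fix u v assume "u \<in> carrier ?D" "v \<in> carrier ?D"
    then obtain x h y k where uv: "u = (x, h)" "v = (y, k)" "x \<in> carrier A" "y \<in> carrier A"
      "h = 0 \<or> h = 1" "k = 0 \<or> k = 1" by (auto simp: carrier)
    then show "f (u \<otimes>\<^bsub>?D\<^esub> v) = f u \<otimes> f v"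
      using \<psi>_P c
      by (auto simp: f_def generalized_dihedral_group_def semidirect_product_def
          inversion_action_def \<psi>_mult m_inv_consistent[OF P] m_assoc c_mult c_mult')
  qed (use \<psi>_P c in \<open>auto simp: carrier f_def\<close>)
  moreover have "bij_betw f (carrier ?D) (carrier G)"
    unfolding bij_betw_def
  proof
    \<comment> \<open>This keeps the images of rotations and reflections apart; within each kind,
      injectivity is that of \<open>\<psi>\<close>.\<close>
    have notP: "x \<otimes> c \<notin> P" if "x \<in> P" for x
    proof
      assume "x \<otimes> c \<in> P"
      then have "inv x \<otimes> (x \<otimes> c) \<in> P" using that by simp
      then show False using that c by (simp add: mult_inv_cancel)
    qed
    have "inj_on \<psi> (carrier A)" using \<psi>(2) by (simp add: bij_betw_def)
    then show "inj_on f (carrier ?D)"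
      using notP \<psi>_P c by (auto simp: inj_on_def carrier f_def) metis+
    have "f ` carrier ?D = \<psi> ` carrier A \<union> (\<lambda>x. x \<otimes> c) ` \<psi> ` carrier A"
      using \<psi>_P by (force simp: carrier f_def image_iff)
    also have "\<dots> = carrier G" using \<psi>(2) carrier_eq by (auto simp: bij_betw_def r_coset_def)
    finally show "f ` carrier ?D = carrier G" .
  qed
  ultimately show ?thesis by (auto simp: is_iso_def iso_def)
qed

end

lemma inverting_involution_generalized_dihedral_group:
  assumes A: "comm_group A"
  shows "inverting_involution (generalized_dihedral_group A) (carrier A \<times> {0}) (\<one>\<^bsub>A\<^esub>, 1)"
proof -
  interpret A: comm_group A by (rule A)
  let ?D = "generalized_dihedral_group A"
  interpret D: group ?D by (rule group_generalized_dihedral_group[OF A])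
  have carrier: "carrier ?D = carrier A \<times> {0, 1}"
    by (auto simp: generalized_dihedral_group_def semidirect_product_def carrier_integer_mod_group)
  have mult: "(x, h) \<otimes>\<^bsub>?D\<^esub> (y, k) = (x \<otimes>\<^bsub>A\<^esub> (if h = 0 then y else inv\<^bsub>A\<^esub> y), (h + k) mod 2)"
    if "y \<in> carrier A" for x h y k
    using that by (simp add: generalized_dihedral_group_def semidirect_product_def inversion_action_def)
  have one: "\<one>\<^bsub>?D\<^esub> = (\<one>\<^bsub>A\<^esub>, 0)"
    by (simp add: generalized_dihedral_group_def semidirect_product_def)
  have inv: "inv\<^bsub>?D\<^esub> (x, 0) = (inv\<^bsub>A\<^esub> x, 0)" if "x \<in> carrier A" for x
    using that by (intro D.inv_equality) (auto simp: carrier mult one)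
  show ?thesis
  proof
    show "carrier ?D = carrier A \<times> {0} \<union> (carrier A \<times> {0} #>\<^bsub>?D\<^esub> (\<one>\<^bsub>A\<^esub>, 1))"
      by (force simp: carrier r_coset_def mult)
  qed (auto simp: carrier mult one inv)
qed

text \<open>Transports the structure of the concrete model to any group isomorphic to it, so that
  \<open>t_group_psquare\<close> applies there.\<close>

lemma inverting_involution_iso:
  assumes f: "f \<in> iso D G" and G: "group G" and D: "inverting_involution D P c"
  shows "inverting_involution G (f ` P) (f c)"
proof -
  interpret D: inverting_involution D P c by (rule D)
  interpret G: group G by (rule G)
  interpret f: group_hom D G f
    using f by (simp add: group_hom_def group_hom_axioms_def iso_def D.is_group G)
  have bij: "inj_on f (carrier D)" "f ` carrier D = carrier G"
    using f by (auto simp: iso_def bij_betw_def)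
  show ?thesis
  proof (rule inverting_involution.intro)
    show "involution_extension G (f ` P) (f c)"
    proof (intro involution_extension.intro involution_extension_axioms.intro G)
      show "subgroup (f ` P) G" by (rule f.subgroup_img_is_subgroup[OF D.P])
      show "f c \<notin> f ` P"
        using bij(1) D.c(1,2) D.P.subset by (auto dest: inj_onD)
      show "f c \<otimes>\<^bsub>G\<^esub> f c = \<one>\<^bsub>G\<^esub>" using D.c f.hom_mult[of c c] by simp
      have "f ` (P #>\<^bsub>D\<^esub> c) = f ` P #>\<^bsub>G\<^esub> f c"
        using D.c by (force simp: r_coset_def image_iff)
      then show "carrier G = f ` P \<union> (f ` P #>\<^bsub>G\<^esub> f c)"
        using bij(2) D.carrier_eq by (metis image_Un)
    qed (use D.c in simp)
    show "inverting_involution_axioms G (f ` P) (f c)"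
    proof
      fix x assume "x \<in> f ` P"
      then obtain y where y: "y \<in> P" "x = f y" by blast
      then have "f (c \<otimes>\<^bsub>D\<^esub> y \<otimes>\<^bsub>D\<^esub> c) = f (inv\<^bsub>D\<^esub> y)" using D.inversion by simp
      then show "f c \<otimes>\<^bsub>G\<^esub> x \<otimes>\<^bsub>G\<^esub> f c = inv\<^bsub>G\<^esub> x" using y D.c by simp
    qed
  qed
qed

subsection \<open>Fixed and inverted elements\<close>

context involution_extension
begin

definition fixed_part :: "'a set" where
  "fixed_part = {x \<in> P. c \<otimes> x \<otimes> c = x}"

definition inverted_part :: "'a set" where
  "inverted_part = {x \<in> P. c \<otimes> x \<otimes> c = inv x}"

end

locale abelian_involution_extension = involution_extension +
  assumes P_comm: "x \<in> P \<Longrightarrow> y \<in> P \<Longrightarrow> x \<otimes> y = y \<otimes> x"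
begin

abbreviation \<sigma> :: "'a \<Rightarrow> 'a" where
  "\<sigma> x \<equiv> c \<otimes> x \<otimes> c"

lemma P_lcomm: "x \<in> P \<Longrightarrow> y \<in> P \<Longrightarrow> z \<in> carrier G \<Longrightarrow> x \<otimes> (y \<otimes> z) = y \<otimes> (x \<otimes> z)"
  using P_comm[of x y] by (simp flip: m_assoc)

lemma inv_c: "inv c = c"
  using c by (simp add: inv_equality)

text \<open>If \<open>\<sigma> x\<close> were \<open>y \<otimes> c\<close> with \<open>y\<close> in
  \<open>P\<close>, then \<open>c \<otimes> x = y\<close> would be in \<open>P\<close>, and with it
  \<open>c\<close>.\<close>

lemma sigma_closed:
  assumes x: "x \<in> P"
  shows "\<sigma> x \<in> P"
proof (rule ccontr)
  assume "\<sigma> x \<notin> P"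
  moreover have "\<sigma> x \<in> carrier G" using x c by simp
  ultimately obtain y where y: "y \<in> P" "\<sigma> x = y \<otimes> c" using not_P_E by blast
  then have "c \<otimes> x = y" using x c by simp
  then have "c \<otimes> x \<otimes> inv x \<in> P" using x y by simp
  then show False using x c by (simp add: m_assoc)
qed

lemma sigma_mult: "x \<in> P \<Longrightarrow> y \<in> P \<Longrightarrow> \<sigma> (x \<otimes> y) = \<sigma> x \<otimes> \<sigma> y"
  using c by (simp add: m_assoc c_c_mult)

lemma sigma_inv: "x \<in> P \<Longrightarrow> \<sigma> (inv x) = inv (\<sigma> x)"
  using c by (simp add: m_assoc inv_mult_group inv_c)

lemma sigma_sigma: "x \<in> P \<Longrightarrow> \<sigma> (\<sigma> x) = x"
  using c by (simp add: m_assoc c_c_mult)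

lemma subgroup_fixed_part: "subgroup fixed_part G"
proof
  show "fixed_part \<subseteq> carrier G" by (auto simp: fixed_part_def)
  show "\<one> \<in> fixed_part" using c by (simp add: fixed_part_def)
  show "x \<otimes> y \<in> fixed_part" if "x \<in> fixed_part" "y \<in> fixed_part" for x y
    using that sigma_mult[of x y] by (simp add: fixed_part_def)
  show "inv x \<in> fixed_part" if "x \<in> fixed_part" for x
    using that sigma_inv[of x] by (simp add: fixed_part_def)
qed

lemma subgroup_inverted_part: "subgroup inverted_part G"
proof
  show "inverted_part \<subseteq> carrier G" by (auto simp: inverted_part_def)
  show "\<one> \<in> inverted_part" using c by (simp add: inverted_part_def)
  show "x \<otimes> y \<in> inverted_part" if "x \<in> inverted_part" "y \<in> inverted_part" for x y
    using that sigma_mult[of x y] P_comm[of "inv x" "inv y"]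
    by (simp add: inverted_part_def inv_mult_group)
  show "inv x \<in> inverted_part" if "x \<in> inverted_part" for x
    using that sigma_inv[of x] by (simp add: inverted_part_def)
qed

text \<open>Elements of \<open>P\<close> act trivially on the abelian group \<open>P\<close> by
  conjugation, so an element \<open>y \<otimes> c\<close> acts on it as \<open>\<sigma>\<close>
  does.\<close>

lemma normal_if_sigma_closed:
  assumes H: "subgroup H G" "H \<subseteq> P" and \<sigma>: "\<And>x. x \<in> H \<Longrightarrow> \<sigma> x \<in> H"
  shows "H \<lhd> G"
proof (rule normal_invI[OF H(1)])
  have conj: "y \<otimes> h \<otimes> inv y = h" if "y \<in> P" "h \<in> P" for y h
    using that P_comm[of y h] by (simp add: m_assoc)
  fix x h assume x: "x \<in> carrier G" and h: "h \<in> H"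
  then have hP: "h \<in> P" using H by blast
  show "x \<otimes> h \<otimes> inv x \<in> H"
  proof (cases "x \<in> P")
    case True
    then show ?thesis using conj h hP by simp
  next
    case False
    then obtain y where y: "y \<in> P" "x = y \<otimes> c" using not_P_E x by blast
    then have "x \<otimes> h \<otimes> inv x = y \<otimes> \<sigma> h \<otimes> inv y"
      using hP c by (simp add: m_assoc inv_mult_group inv_c)
    also have "\<dots> = \<sigma> h" using conj y(1) sigma_closed[OF hP] by simp
    finally show ?thesis using \<sigma>[OF h] by simp
  qed
qed

lemma normal_fixed_part: "fixed_part \<lhd> G"
  by (rule normal_if_sigma_closed[OF subgroup_fixed_part]) (auto simp: fixed_part_def)

lemma normal_inverted_part: "inverted_part \<lhd> G"
  by (rule normal_if_sigma_closed[OF subgroup_inverted_part])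
    (use subgroup.m_inv_closed[OF subgroup_inverted_part] in \<open>auto simp: inverted_part_def\<close>)

lemma square_eq_one:
  assumes odd: "odd (card P)" and x: "x \<in> P" "x \<otimes> x = \<one>"
  shows "x = \<one>"
proof -
  obtain k where k: "card P = 2 * k + 1" using odd oddE by blast
  have "x [^] (2::nat) = \<one>" using x by (simp add: numeral_2_eq_2)
  then have "x [^] (2 * k + 1) = x" using x by (simp add: nat_pow_pow[symmetric])
  then show ?thesis using pow_card_subgroup[OF P x(1)] k by simp
qed

lemma fixed_inverted_Int:
  assumes "odd (card P)" "x \<in> fixed_part" "x \<in> inverted_part"
  shows "x = \<one>"
proof -
  have x: "x \<in> P" "x = inv x" using assms by (auto simp: fixed_part_def inverted_part_def)
  then have "x \<otimes> x = \<one>" by (metis P.mem_carrier r_inv)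
  then show ?thesis using square_eq_one assms(1) x(1) by blast
qed

text \<open>If \<open>y\<close> is the square root of \<open>x\<close> in \<open>P\<close>, then \<open>x = y \<sigma>(y) \<cdot> y \<sigma>(y)\<^sup>-\<^sup>1\<close>.\<close>
lemma card_fixed_inverted:
  assumes odd: "odd (card P)"
  shows "card fixed_part * card inverted_part = card P"
proof -
  have "bij_betw (\<lambda>(u, v). u \<otimes> v) (fixed_part \<times> inverted_part) P"
    unfolding bij_betw_def
  proof (intro conjI equalityI subsetI)
    interpret group_disjoint_sum G fixed_part inverted_part
      using subgroup_fixed_part subgroup_inverted_part by (simp add: group_disjoint_sum_def is_group)
    have "fixed_part \<inter> inverted_part \<subseteq> {\<one>}" using fixed_inverted_Int[OF odd] by blast
    then show "inj_on (\<lambda>(u, v). u \<otimes> v) (fixed_part \<times> inverted_part)"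
      using cancel by (auto simp: inj_on_def)
    fix x assume x: "x \<in> P"
    obtain k where k: "card P = 2 * k + 1" using odd oddE by blast
    \<comment> \<open>With \<open>card P = 2 * k + 1\<close>, the square of
      \<open>x [^] (k + 1)\<close> is \<open>x [^] (card P + 1)\<close>, which is
      \<open>x\<close>.\<close>
    define y where "y = x [^] (k + 1)"
    have "x [^] n \<in> P" for n :: nat using x by (induction n) auto
    then have y: "y \<in> P" unfolding y_def .
    have "y \<otimes> y = x [^] ((k + 1) + (k + 1))" unfolding y_def by (rule nat_pow_mult) (use x in simp)
    also have "(k + 1) + (k + 1) = card P + 1" using k by simp
    finally have yy: "y \<otimes> y = x" using pow_card_subgroup[OF P x] x by simp
    have "y \<otimes> \<sigma> y \<in> fixed_part"
      using y sigma_closed[OF y] sigma_mult[OF y sigma_closed[OF y]] sigma_sigma[OF y] P_comm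
      by (simp add: fixed_part_def)
    moreover have "y \<otimes> inv (\<sigma> y) \<in> inverted_part"
      using y sigma_closed[OF y] sigma_mult[of y "inv (\<sigma> y)"] sigma_inv[OF sigma_closed[OF y]]
        sigma_sigma[OF y]
      by (simp add: inverted_part_def inv_mult_group)
    moreover have "(y \<otimes> \<sigma> y) \<otimes> (y \<otimes> inv (\<sigma> y)) = y \<otimes> (y \<otimes> (\<sigma> y \<otimes> inv (\<sigma> y)))"
      using y sigma_closed[OF y] P_lcomm[of "\<sigma> y" y "inv (\<sigma> y)"] by (simp add: m_assoc)
    then have "(y \<otimes> \<sigma> y) \<otimes> (y \<otimes> inv (\<sigma> y)) = x" using y c yy by simp
    ultimately show "x \<in> (\<lambda>(u, v). u \<otimes> v) ` (fixed_part \<times> inverted_part)" by force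
  qed (auto simp: fixed_part_def inverted_part_def)
  then show ?thesis by (metis bij_betw_same_card card_cartesian_product)
qed


text \<open>Elements \<open>u \<otimes> inv (\<sigma> u)\<close> are inverted by \<open>c\<close>,
  and every commutator is trivial, such an element, an inverse of one, or a product of these. Hence
  the quotient by \<open>inverted_part\<close> is abelian.\<close>

lemma commutator_inverted_part:
  assumes x: "x \<in> carrier G" and y: "y \<in> carrier G"
  shows "x \<otimes> y \<otimes> inv (y \<otimes> x) \<in> inverted_part"
proof -
  interpret I: subgroup inverted_part G by (rule subgroup_inverted_part)
  define \<delta> where "\<delta> u = u \<otimes> inv (\<sigma> u)" for u
  have \<delta>: "\<delta> u \<in> inverted_part" if u: "u \<in> P" for u
    using u sigma_closed[OF u] sigma_mult[of u "inv (\<sigma> u)"] sigma_inv[OF sigma_closed[OF u]]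
      sigma_sigma[OF u] P_comm[of "\<sigma> u" "inv u"]
    by (simp add: \<delta>_def inverted_part_def inv_mult_group)
  have mixed: "u \<otimes> v \<otimes> inv (v \<otimes> u) \<in> inverted_part"
    if u: "u \<in> P" and v: "v \<in> carrier G" "v \<notin> P" for u v
  proof -
    obtain w where w: "w \<in> P" "v = w \<otimes> c" using not_P_E[OF v] by blast
    have "u \<otimes> v \<otimes> inv (v \<otimes> u) = u \<otimes> (w \<otimes> (\<sigma> (inv u) \<otimes> inv w))"
      using u w c by (simp add: m_assoc inv_mult_group inv_c)
    also have "\<dots> = u \<otimes> \<sigma> (inv u)"
      using u w sigma_closed[of "inv u"] P_comm[of w "\<sigma> (inv u) \<otimes> inv w"] by (simp add: m_assoc)
    also have "\<dots> = \<delta> u" using sigma_inv[OF u] by (simp add: \<delta>_def)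
    finally show ?thesis using \<delta>[OF u] by simp
  qed
  consider "x \<in> P" "y \<in> P" | "x \<in> P" "y \<notin> P" | "x \<notin> P" "y \<in> P" | "x \<notin> P" "y \<notin> P" by blast
  then show ?thesis
  proof cases
    case 1
    then show ?thesis using P_comm[of x y] by simp
  next
    case 2
    then show ?thesis using mixed y by blast
  next
    case 3
    then have "inv (y \<otimes> x \<otimes> inv (x \<otimes> y)) \<in> inverted_part" using mixed x by blast
    then show ?thesis using x y by (simp add: inv_mult_group m_assoc)
  next
    case 4
    obtain u v where uv: "u \<in> P" "x = u \<otimes> c" "v \<in> P" "y = v \<otimes> c"
      using not_P_E[OF x 4(1)] not_P_E[OF y 4(2)] by metis
    have "x \<otimes> y \<otimes> inv (y \<otimes> x) = u \<otimes> \<sigma> v \<otimes> inv (v \<otimes> \<sigma> u)"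
      using uv c by (simp add: m_assoc inv_mult_group inv_c)
    also have "\<dots> = \<delta> u \<otimes> inv (\<delta> v)"
      using uv sigma_closed[OF uv(1)] sigma_closed[OF uv(3)]
        P_comm[of "\<sigma> v" "inv (\<sigma> u) \<otimes> inv v"] P_comm[of "inv v" "\<sigma> v"]
      by (simp add: \<delta>_def m_assoc inv_mult_group)
    finally show ?thesis using \<delta> uv by simp
  qed
qed

text \<open>The commutator of an inverted \<open>x\<close> with \<open>c\<close> is
  \<open>x \<otimes> x\<close>, again inverted. Were it also fixed, it would be
  \<open>\<one>\<close>, and \<open>x\<close> too, as \<open>P\<close> has odd order. Hence the
  quotient by \<open>fixed_part\<close> is not abelian if such an \<open>x\<close> exists.\<close>

lemma commutator_fixed_part:
  assumes odd: "odd (card P)" and x: "x \<in> inverted_part" "x \<noteq> \<one>"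
  shows "x \<otimes> c \<otimes> inv (c \<otimes> x) \<notin> fixed_part"
proof
  have xP: "x \<in> P" "\<sigma> x = inv x" using x(1) by (auto simp: inverted_part_def)
  have "x \<otimes> c \<otimes> inv (c \<otimes> x) = x \<otimes> \<sigma> (inv x)"
    using xP(1) c by (simp add: m_assoc inv_mult_group inv_c)
  then have eq: "x \<otimes> c \<otimes> inv (c \<otimes> x) = x \<otimes> x"
    using xP sigma_inv[OF xP(1)] by simp
  assume "x \<otimes> c \<otimes> inv (c \<otimes> x) \<in> fixed_part"
  then have "x \<otimes> x \<in> fixed_part" using eq by simp
  moreover have "x \<otimes> x \<in> inverted_part"
    using x(1) subgroup.m_closed[OF subgroup_inverted_part] by blast
  ultimately have "x \<otimes> x = \<one>" using fixed_inverted_Int[OF odd] by blast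
  then show False using square_eq_one[OF odd xP(1)] x(2) by blast
qed

end

section \<open>The classification\<close>

lemma (in normal) comm_group_FactGroup_iff:
  "comm_group (G Mod H) \<longleftrightarrow>
    (\<forall>x \<in> carrier G. \<forall>y \<in> carrier G. x \<otimes> y \<otimes> inv (y \<otimes> x) \<in> H)" (is "_ \<longleftrightarrow> ?R")
proof -
  have eq: "(H #> x) <#> (H #> y) = (H #> y) <#> (H #> x) \<longleftrightarrow> x \<otimes> y \<otimes> inv (y \<otimes> x) \<in> H"
    if "x \<in> carrier G" "y \<in> carrier G" for x y
    using that rcos_eq_iff[OF is_subgroup, of "x \<otimes> y" "y \<otimes> x"] by (simp add: rcos_sum)
  show ?thesis
  proof
    assume "comm_group (G Mod H)"
    then interpret Q: comm_group "G Mod H" .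
    show ?R using eq Q.m_comm by (simp add: FactGroup_def RCOSETS_def) blast
  next
    assume ?R
    then have "C <#> D = D <#> C" if "C \<in> rcosets H" "D \<in> rcosets H" for C D
      using that eq by (auto simp: RCOSETS_def)
    then show "comm_group (G Mod H)"
      by (intro group.group_comm_groupI[OF factorgroup_is_group]) (simp_all add: FactGroup_def)
  qed
qed

context group
begin

text \<open>\<open>P\<close> is a Sylow \<open>p\<close>-subgroup, abelian because its order is the
  square of a prime, and \<open>c\<close> generates a Sylow subgroup of order two.\<close>

lemma ex_involution_extension:
  assumes p: "Factorial_Ring.prime p" "odd p" and order: "order G = 2 * p ^ 2"
  shows "\<exists>P c. card P = p ^ 2 \<and> abelian_involution_extension G P c"
proof -
  have fin: "finite (carrier G)"
    using order prime_gt_0_nat[OF p(1)] by (simp flip: order_gt_0_iff_finite)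
  obtain P where P: "subgroup P G" "card P = p ^ 2"
    using sylow_thm[OF p(1) is_group, of 2 2] order fin by auto
  obtain C where C: "subgroup C G" "card C = 2"
    using sylow_thm[of 2 G 1 "p ^ 2"] is_group order fin by auto
  have "C \<noteq> {\<one>}" using C(2) by auto
  then obtain c where c: "c \<in> C" "c \<noteq> \<one>" using subgroup.one_closed[OF C(1)] by blast
  have cG: "c \<in> carrier G" using c C subgroup.mem_carrier by metis
  have c2: "c [^] (2::nat) = \<one>" using pow_card_subgroup[OF C(1) c(1)] C(2) by simp
  have cP: "c \<notin> P"
  proof
    assume "c \<in> P"
    then have "ord c dvd p ^ 2" using pow_card_subgroup[OF P(1)] P(2) cG pow_eq_id by metis
    moreover have "ord c dvd 2" using c2 cG by (simp add: pow_eq_id)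
    moreover have "coprime (p ^ 2) 2" using p by simp
    ultimately have "ord c = 1" by (metis coprime_common_divisor_nat)
    then show False using c cG ord_eq_1 by metis
  qed
  have sub: "P \<union> (P #> c) \<subseteq> carrier G"
    using subgroup.subset[OF P(1)] r_coset_subset_G cG by blast
  \<comment> \<open>The cosets of \<open>\<one>\<close> and \<open>c\<close> are distinct, hence
    disjoint; together they have \<open>2 * p ^ 2\<close> elements and exhaust the group.\<close>
  have "P \<inter> (P #> c) = {}"
  proof -
    have "P #> \<one> \<noteq> P #> c"
      using rcos_self[OF cG P(1)] cP coset_mult_one[OF subgroup.subset[OF P(1)]] by auto
    then show ?thesis
      using rcos_disjoint[OF P(1)] rcosetsI[OF subgroup.subset[OF P(1)]] cG
        coset_mult_one[OF subgroup.subset[OF P(1)]] one_closed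
      by (metis disjnt_def pairwiseD)
  qed
  moreover have "card (P #> c) = card P"
    using card_rcosets_equal[OF rcosetsI[OF subgroup.subset[OF P(1)] cG]] subgroup.subset[OF P(1)]
    by simp
  moreover have "finite P" "finite (P #> c)" using sub fin finite_subset by auto
  ultimately have "card (P \<union> (P #> c)) = card (carrier G)"
    using order P(2) by (simp add: card_Un_disjoint order_def)
  then have carrier: "carrier G = P \<union> (P #> c)" using sub fin card_subset_eq by metis
  interpret PG: comm_group "G\<lparr>carrier := P\<rparr>"
    using group.psquare_comm_group[OF subgroup_imp_group[OF P(1)] p(1)] P(2)
    by (simp add: order_def)
  have "abelian_involution_extension G P c"
  proof (intro abelian_involution_extension.intro involution_extension.intro
      involution_extension_axioms.intro abelian_involution_extension_axioms.intro is_group)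
    show "x \<otimes> y = y \<otimes> x" if "x \<in> P" "y \<in> P" for x y using PG.m_comm[of x y] that by simp
  qed (use P(1) cG cP c2 carrier in \<open>auto simp: numeral_2_eq_2\<close>)
  then show ?thesis using P(2) by blast
qed

lemma nonabelian_t_group_imp_inverting:
  assumes p: "Factorial_Ring.prime p" "odd p" and order: "order G = 2 * p ^ 2"
    and nonabelian: "\<not> comm_group G" and t: "t_group G"
  shows "\<exists>P c. inverting_involution G P c"
proof -
  obtain P c where card: "card P = p ^ 2" and ext: "abelian_involution_extension G P c"
    using ex_involution_extension[OF p order] by blast
  interpret abelian_involution_extension G P c by (rule ext)
  have odd: "odd (card P)" using card p by simp
  have finP: "finite P" using card prime_gt_0_nat[OF p(1)] by (intro card_ge_0_finite) simp
  have sub: "fixed_part \<subseteq> P" "inverted_part \<subseteq> P" by (auto simp: fixed_part_def inverted_part_def)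
  have prod: "card fixed_part * card inverted_part = p ^ 2"
    using card_fixed_inverted[OF odd] card by simp
  then have "card fixed_part dvd p ^ 2" by (metis dvd_triv_left)
  then obtain i where i: "i \<le> 2" "card fixed_part = p ^ i"
    using p divides_primepow_nat by blast
  have "i = 0 \<or> i = 1 \<or> i = 2" using i(1) by linarith
  then consider "card fixed_part = 1" | "card fixed_part = p" | "card fixed_part = p ^ 2"
    using i(2) by auto
  then show ?thesis
  proof cases
    case 1
    then have "inverted_part = P"
      using prod card sub(2) finP card_subset_eq[of P inverted_part] by simp
    then have "c \<otimes> x \<otimes> c = inv x" if "x \<in> P" for x using that by (auto simp: inverted_part_def)
    then have "inverting_involution G P c"
      by (intro inverting_involution.intro inverting_involution_axioms.intro involution_extension_axioms) 
    then show ?thesis by blast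
  next
    case 2
    then have card_eq: "card fixed_part = card inverted_part"
      using prod prime_gt_0_nat[OF p(1)] by (simp add: power2_eq_square)
    have "inverted_part \<noteq> {\<one>}" using card_eq 2 p by auto
    then obtain x where x: "x \<in> inverted_part" "x \<noteq> \<one>"
      using subgroup.one_closed[OF subgroup_inverted_part] by blast
    then have xG: "x \<in> carrier G" using subgroup.mem_carrier[OF subgroup_inverted_part] by blast
    \<comment> \<open>Being distinct and of equal order, the two subgroups are adjacent in a
      t-group; this makes their quotients isomorphic, although only the one by
      \<open>inverted_part\<close> is abelian.\<close>
    have "fixed_part \<noteq> inverted_part" using x fixed_inverted_Int[OF odd] by blast
    then obtain S1 S2 where "S1 \<in> NRT G inverted_part" "S2 \<in> NRT G fixed_part"
      "NRT_loop G inverted_part S1 \<cong> NRT_loop G fixed_part S2"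
      using t card_eq subgroup_fixed_part subgroup_inverted_part unfolding t_group_iff by metis
    then have iso: "G Mod inverted_part \<cong> G Mod fixed_part"
      using NRT_loops_iso_imp_FactGroups_iso normal_inverted_part normal_fixed_part by blast
    have "comm_group (G Mod inverted_part)"
      using normal.comm_group_FactGroup_iff[OF normal_inverted_part] commutator_inverted_part by blast
    then have "comm_group (G Mod fixed_part)"
      by (rule comm_group.iso_imp_comm_group[OF _ iso
            group.is_monoid[OF normal.factorgroup_is_group[OF normal_fixed_part]]])
    then have "x \<otimes> c \<otimes> inv (c \<otimes> x) \<in> fixed_part"
      using normal.comm_group_FactGroup_iff[OF normal_fixed_part] xG c(1) by blast
    then show ?thesis using commutator_fixed_part[OF odd x] by blast
  next
    case 3
    then have "fixed_part = P"
      using card sub(1) finP card_subset_eq[of P fixed_part] by simp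
    then have \<sigma>: "c \<otimes> x \<otimes> c = x" if "x \<in> P" for x using that by (auto simp: fixed_part_def)
    \<comment> \<open>Here \<open>c\<close> centralizes \<open>P\<close>, which makes
      \<open>G\<close> abelian, against the hypothesis.\<close>
    have cx: "c \<otimes> x = x \<otimes> c" if "x \<in> P" for x
    proof -
      have "c \<otimes> x \<otimes> c \<otimes> c = x \<otimes> c" using \<sigma>[OF that] by simp
      then show ?thesis using that c by (simp add: m_assoc)
    qed
    have cx': "c \<otimes> (x \<otimes> y) = x \<otimes> (c \<otimes> y)" if "x \<in> P" "y \<in> carrier G" for x y
      using cx[OF that(1)] that c by (simp flip: m_assoc)
    have "comm_group G"
    proof (rule group_comm_groupI)
      fix x y assume "x \<in> carrier G" "y \<in> carrier G"
      moreover have "\<exists>u \<in> P. x = u \<or> x = u \<otimes> c" if "x \<in> carrier G" for x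
        using that not_P_E by metis
      ultimately obtain u v where "u \<in> P" "v \<in> P" "x = u \<or> x = u \<otimes> c" "y = v \<or> y = v \<otimes> c" by meson
      then show "x \<otimes> y = y \<otimes> x"
        using P_comm[of u v] P_lcomm[of u v c] c by (auto simp: m_assoc cx cx')
    qed
    then show ?thesis using nonabelian by blast
  qed
qed

lemma t_group_if_iso_generalized_dihedral_group:
  assumes p: "Factorial_Ring.prime p" "odd p" and order: "order G = 2 * p ^ 2"
    and A: "comm_group A" and iso: "G \<cong> generalized_dihedral_group A"
  shows "t_group G"
proof -
  have fin: "finite (carrier G)"
    using order prime_gt_0_nat[OF p(1)] by (simp flip: order_gt_0_iff_finite)
  \<comment> \<open>The isomorphism is taken from the model to \<open>G\<close>, so that the image
    of the rotation subgroup serves as \<open>P\<close>.\<close>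
  obtain f where "f \<in> iso (generalized_dihedral_group A) G"
    using iso_sym[OF iso] by (auto simp: is_iso_def)
  then interpret inverting_involution G "f ` (carrier A \<times> {0})" "f (\<one>\<^bsub>A\<^esub>, 1)"
    using is_group inverting_involution_generalized_dihedral_group[OF A]
    by (rule inverting_involution_iso)
  show ?thesis using t_group_psquare[OF p fin] order_eq[OF fin] order by simp
qed

end

theorem proposition3p6:
  fixes p :: nat and G :: "('a, 'm) monoid_scheme"
  assumes "Factorial_Ring.prime p" and "odd p"
    and "group G" and "\<not> comm_group G" and "order G = 2 * p ^ 2"
  shows "t_group G \<longleftrightarrow> G \<cong> dihedral_group (p ^ 2) \<or> G \<cong> Cp2_C2 p"
proof -
  interpret group G by fact
  have fin: "finite (carrier G)"
    using assms(5) prime_gt_0_nat[OF assms(1)] by (simp flip: order_gt_0_iff_finite)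
  have A: "comm_group (integer_mod_group p \<times>\<times> integer_mod_group p)"
    by (rule group.group_comm_groupI) (auto simp: DirProd_group add.commute)
  show ?thesis
  proof
    assume "t_group G"
    then obtain P c where inv: "inverting_involution G P c"
      using nonabelian_t_group_imp_inverting assms by blast
    then interpret inverting_involution G P c .
    \<comment> \<open>\<open>P\<close> has index two, hence order \<open>p ^ 2\<close>; the two
      isomorphism types of that order produce the two groups of the classification.\<close>
    have "order (G\<lparr>carrier := P\<rparr>) = p ^ 2" using order_eq[OF fin] assms(5) by (simp add: order_def)
    then have "integer_mod_group (p ^ 2) \<cong> G\<lparr>carrier := P\<rparr> \<or>
        integer_mod_group p \<times>\<times> integer_mod_group p \<cong> G\<lparr>carrier := P\<rparr>"
      by (rule group.psquare_iso[OF subgroup_imp_group[OF P] assms(1)])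
    then show "G \<cong> dihedral_group (p ^ 2) \<or> G \<cong> Cp2_C2 p"
    proof
      assume "integer_mod_group (p ^ 2) \<cong> G\<lparr>carrier := P\<rparr>"
      then have "generalized_dihedral_group (integer_mod_group (p ^ 2)) \<cong> G"
        by (rule generalized_dihedral_group_iso[OF abelian_integer_mod_group])
      then show ?thesis
        unfolding dihedral_group_def
        using group.iso_sym[OF group_generalized_dihedral_group[OF abelian_integer_mod_group]] by blast
    next
      assume "integer_mod_group p \<times>\<times> integer_mod_group p \<cong> G\<lparr>carrier := P\<rparr>"
      then have "generalized_dihedral_group (integer_mod_group p \<times>\<times> integer_mod_group p) \<cong> G"
        by (rule generalized_dihedral_group_iso[OF A])
      then show ?thesis
        unfolding Cp2_C2_def
        using group.iso_sym[OF group_generalized_dihedral_group[OF A]] by blast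
    qed
  next
    assume "G \<cong> dihedral_group (p ^ 2) \<or> G \<cong> Cp2_C2 p"
    then show "t_group G"
    proof
      assume "G \<cong> dihedral_group (p ^ 2)"
      then show ?thesis unfolding dihedral_group_def
        by (rule t_group_if_iso_generalized_dihedral_group[OF assms(1,2,5) abelian_integer_mod_group])
    next
      assume "G \<cong> Cp2_C2 p"
      then show ?thesis unfolding Cp2_C2_def
        by (rule t_group_if_iso_generalized_dihedral_group[OF assms(1,2,5) A])
    qed
  qed
qed

end
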